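(* Let $d\geq 2$, let $\beta\colon \mathrm{Pol}(O_d^+)\to\mathcal{B}$ be a surjective unital ${}^*$-homomorphism onto a unital ${}^*$-algebra $\mathcal{B}=\mathrm{Pol}(\mathbb{X})$ which admits a faithful ${}^*$-representation on a Hilbert space, and write $\dot u_{ij}=\beta(u_{ij})$. Let $(\mathcal{A},\varphi)$ be a non-commutative probability space and let $X_1,\dots,X_d\in\mathcal{A}$ be self-adjoint, freely independent and identically distributed. Put $Y_j=\sum_{i=1}^d X_i\otimes\dot u_{ij}\in\mathcal{A}\otimes\mathcal{B}$ for $j=1,\dots,d$. Suppose that $Y_1,\dots,Y_d$ are free with amalgamation over $\mathcal{B}$ in the $\mathcal{B}$-valued probability space $(\mathcal{A}\otimes\mathcal{B},\mathcal{B},E)$, $E=\varphi\otimes\mathrm{id}$. Then either $\mathbb{X}\subset H_d^+$ (i.e. $\dot u_{ij}^2=\dot u_{ij}^4$ for all $i,j$, equivalently $\beta$ factors through $\mathrm{Pol}(H_d^+)$), or $X_1,\dots,X_d$ are semicircular, i.e. $\kappa_n(X_i)=0$ for all $n\geq 3$ and all $i$.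
   Context: $\mathrm{Pol}(O_d^+)$ is the universal unital ${}^*$-algebra generated by $d^2$ self-adjoint elements $u_{ij}$ ($1\le i,j\le d$) such that the matrix $u=(u_{ij})$ satisfies $u^\top u=uu^\top=\mathbb{1}$, i.e. $\sum_i u_{ij}^2=\mathbb 1=\sum_j u_{ij}^2$ and $\sum_i u_{ij}u_{ij'}=0=\sum_j u_{ij}u_{i'j}$ for $i\ne i'$, $j\neq j'$. $\mathrm{Pol}(H_d^+)$ is the quotient of $\mathrm{Pol}(O_d^+)$ by the ideal generated by $u_{ij}u_{ij'}$ and $u_{ji}u_{j'i}$ for all $i$ and $j\ne j'$ (in a C*-setting equivalent to adding $u_{ij}^3=u_{ij}$). A non-commutative probability space $(\mathcal{A},\varphi)$ is a unital ${}^*$-algebra with a unital positive linear functional. For a ${}^*$-subalgebra $\mathcal B\subset\mathcal C$ and a conditional expectation $E\colon\mathcal C\to\mathcal B$ ($E(b)=b$, $E(b_1ab_2)=b_1E(a)b_2$), subalgebras $\mathcal C_k\supset\mathcal B$ are free with amalgamation over $\mathcal B$ if $E(a_1\cdots a_n)=0$ whenever $a_r\in\mathcal C_{k_r}$, $k_1\ne k_2\ne\dots\ne k_n$, $E(a_r)=0$; elements are free with amalgamation if the algebras they generate together with $\mathcal B$ are. Here $\mathcal B$ is identified with $\mathbb 1\otimes\mathcal B$. $\kappa_n$ denotes the scalar free cumulants of $(\mathcal A,\varphi)$, defined by $\varphi(a_1\cdots a_m)=\sum_{\pi\in NC(m)}\prod_{B\in\pi}\kappa_{|B|}(a_i:i\in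 B)$, and $\kappa_n(X)=\kappa_n(X,\dots,X)$. *)

theory Defs
  imports Complex_Main "HOL-Library.Disjoint_Sets"
begin

class star_algebra = ring_1 +
  fixes cscale :: "complex \<Rightarrow> 'a \<Rightarrow> 'a"
    and sadj :: "'a \<Rightarrow> 'a"
  assumes cscale_add_right: "cscale c (x + y) = cscale c x + cscale c y"
    and cscale_add_left: "cscale (c + e) x = cscale c x + cscale e x"
    and cscale_cscale: "cscale c (cscale e x) = cscale (c * e) x"
    and cscale_one: "cscale 1 x = x"
    and cscale_mult_left: "cscale c x * y = cscale c (x * y)"
    and cscale_mult_right: "x * cscale c y = cscale c (x * y)"
    and sadj_sadj: "sadj (sadj x) = x"
    and sadj_add: "sadj (x + y) = sadj x + sadj y"
    and sadj_mult: "sadj (x * y) = sadj y * sadj x"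
    and sadj_cscale: "sadj (cscale c x) = cscale (cnj c) (sadj x)"

inductive_set salg :: "'a::star_algebra set \<Rightarrow> 'a set" for S where
  salg_one: "1 \<in> salg S"
| salg_gen: "x \<in> S \<Longrightarrow> x \<in> salg S"
| salg_add: "x \<in> salg S \<Longrightarrow> y \<in> salg S \<Longrightarrow> x + y \<in> salg S"
| salg_mult: "x \<in> salg S \<Longrightarrow> y \<in> salg S \<Longrightarrow> x * y \<in> salg S"
| salg_scale: "x \<in> salg S \<Longrightarrow> cscale c x \<in> salg S"
| salg_adj: "x \<in> salg S \<Longrightarrow> sadj x \<in> salg S"

class chilbert = ab_group_add +
  fixes hscale :: "complex \<Rightarrow> 'a \<Rightarrow> 'a"
    and hinner :: "'a \<Rightarrow> 'a \<Rightarrow> complex"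
  assumes hscale_add_right: "hscale c (x + y) = hscale c x + hscale c y"
    and hscale_add_left: "hscale (c + e) x = hscale c x + hscale e x"
    and hscale_hscale: "hscale c (hscale e x) = hscale (c * e) x"
    and hscale_one: "hscale 1 x = x"
    and hinner_add_right: "hinner x (y + z) = hinner x y + hinner x z"
    and hinner_scale_right: "hinner x (hscale c y) = c * hinner x y"
    and hinner_cnj: "hinner y x = cnj (hinner x y)"
    and hinner_pos: "Im (hinner x x) = 0 \<and> Re (hinner x x) \<ge> 0"
    and hinner_definite: "hinner x x = 0 \<Longrightarrow> x = 0"
    and hcomplete: "(\<forall>\<epsilon>>0. \<exists>N. \<forall>m\<ge>N. \<forall>n\<ge>N.
                       sqrt (Re (hinner (f m - f n) (f m - f n))) < \<epsilon>) \<Longrightarrow>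
                    \<exists>l. (\<lambda>n. sqrt (Re (hinner (f n - l) (f n - l)))) \<longlonglongrightarrow> 0"

definition hnorm :: "'h::chilbert \<Rightarrow> real" where
  "hnorm x = sqrt (Re (hinner x x))"

definition faithful_star_rep :: "('b::star_algebra \<Rightarrow> 'h::chilbert \<Rightarrow> 'h) \<Rightarrow> bool" where
  "faithful_star_rep \<pi> \<longleftrightarrow>
     (\<forall>b x y. \<pi> b (x + y) = \<pi> b x + \<pi> b y) \<and>
     (\<forall>b c x. \<pi> b (hscale c x) = hscale c (\<pi> b x)) \<and>
     (\<forall>b. \<exists>K. \<forall>x. hnorm (\<pi> b x) \<le> K * hnorm x) \<and>
     (\<forall>b c x. \<pi> (b + c) x = \<pi> b x + \<pi> c x) \<and>
     (\<forall>b c x. \<pi> (cscale c b) x = hscale c (\<pi> b x)) \<and>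
     (\<forall>b c x. \<pi> (b * c) x = \<pi> b (\<pi> c x)) \<and>
     (\<forall>x. \<pi> 1 x = x) \<and>
     (\<forall>b x y. hinner (\<pi> b x) y = hinner x (\<pi> (sadj b) y)) \<and>
     inj \<pi>"

definition ncps :: "('a::star_algebra \<Rightarrow> complex) \<Rightarrow> bool" where
  "ncps \<phi> \<longleftrightarrow>
     (\<forall>x y. \<phi> (x + y) = \<phi> x + \<phi> y) \<and> (\<forall>c x. \<phi> (cscale c x) = c * \<phi> x) \<and>
     \<phi> 1 = 1 \<and> (\<forall>x. Im (\<phi> (sadj x * x)) = 0 \<and> Re (\<phi> (sadj x * x)) \<ge> 0)"

definition freely_independent ::
  "('a::star_algebra \<Rightarrow> complex) \<Rightarrow> nat \<Rightarrow> (nat \<Rightarrow> 'a) \<Rightarrow> bool" where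
  "freely_independent \<phi> d X \<longleftrightarrow>
     (\<forall>ks as. length as = length ks \<and> ks \<noteq> [] \<and>
        (\<forall>r<length ks. ks ! r \<in> {1..d} \<and> as ! r \<in> salg {X (ks ! r)} \<and> \<phi> (as ! r) = 0) \<and>
        (\<forall>r. Suc r < length ks \<longrightarrow> ks ! r \<noteq> ks ! Suc r)
      \<longrightarrow> \<phi> (prod_list as) = 0)"

definition noncrossing :: "nat set set \<Rightarrow> bool" where
  "noncrossing P \<longleftrightarrow>
     (\<forall>B1\<in>P. \<forall>B2\<in>P. B1 \<noteq> B2 \<longrightarrow>
        \<not> (\<exists>a b c e. a < b \<and> b < c \<and> c < e \<and> a \<in> B1 \<and> c \<in> B1 \<and> b \<in> B2 \<and> e \<in> B2))"

definition NC :: "nat \<Rightarrow> nat set set set" where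
  "NC m = {P. partition_on {..<m} P \<and> noncrossing P}"

text \<open>\<open>\<kappa>\<close> is the family of scalar free cumulants of \<open>(\<A>,\<phi>)\<close>: \<open>\<kappa> [a1,...,an]\<close> is
  \<open>\<kappa>_n(a1,...,an)\<close>, characterised by the moment-cumulant formula (which determines
  \<open>\<kappa>\<close> uniquely on non-empty lists).\<close>
definition free_cumulants :: "('a::star_algebra \<Rightarrow> complex) \<Rightarrow> ('a list \<Rightarrow> complex) \<Rightarrow> bool" where
  "free_cumulants \<phi> \<kappa> \<longleftrightarrow>
     (\<forall>as. \<phi> (prod_list as) = (\<Sum>P\<in>NC (length as). \<Prod>B\<in>P. \<kappa> (nths as B)))"

text \<open>A word \<open>b0 Y_{j1} b1 \<dots>\<close> in \<open>\<A> \<otimes> \<B>\<close> is a list of letters: \<open>LB b\<close> stands for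
  \<open>1 \<otimes> b\<close>, \<open>LY j\<close> for \<open>Y_j = \<Sum>_i X_i \<otimes> u_{ij}\<close>; products are concatenations.\<close>
datatype 'b letter = LB 'b | LY nat

text \<open>\<open>Ew \<phi> X u d x b w = E((x \<otimes> b) \<cdot> w)\<close> where \<open>E = \<phi> \<otimes> id\<close>.\<close>
fun Ew :: "('a::star_algebra \<Rightarrow> complex) \<Rightarrow> (nat \<Rightarrow> 'a) \<Rightarrow> (nat \<Rightarrow> nat \<Rightarrow> 'b::star_algebra)
           \<Rightarrow> nat \<Rightarrow> 'a \<Rightarrow> 'b \<Rightarrow> 'b letter list \<Rightarrow> 'b" where
  "Ew \<phi> X u d x b [] = cscale (\<phi> x) b"
| "Ew \<phi> X u d x b (LB c # w) = Ew \<phi> X u d x (b * c) w"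
| "Ew \<phi> X u d x b (LY j # w) = (\<Sum>i\<in>{1..d}. Ew \<phi> X u d (x * X i) (b * u i j) w)"

definition Esum :: "('a::star_algebra \<Rightarrow> complex) \<Rightarrow> (nat \<Rightarrow> 'a) \<Rightarrow> (nat \<Rightarrow> nat \<Rightarrow> 'b::star_algebra)
           \<Rightarrow> nat \<Rightarrow> 'b letter list list \<Rightarrow> 'b" where
  "Esum \<phi> X u d ws = (\<Sum>w\<leftarrow>ws. Ew \<phi> X u d 1 1 w)"

text \<open>Every element of the (*-)algebra generated by \<open>1 \<otimes> \<B>\<close> and \<open>Y_k\<close> is a finite sum of
  words using only \<open>B\<close>-letters and \<open>Y_k\<close>; the product of such sums is the sum of all
  concatenations. Freeness with amalgamation over \<open>\<B>\<close> of \<open>Y_1,\<dots>,Y_d\<close> w.r.t. \<open>E\<close>:\<close>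
definition amalg_free_Y ::
  "('a::star_algebra \<Rightarrow> complex) \<Rightarrow> (nat \<Rightarrow> 'a) \<Rightarrow> (nat \<Rightarrow> nat \<Rightarrow> 'b::star_algebra) \<Rightarrow> nat \<Rightarrow> bool" where
  "amalg_free_Y \<phi> X u d \<longleftrightarrow>
     (\<forall>ks (as :: 'b letter list list list). length as = length ks \<and> ks \<noteq> [] \<and>
        (\<forall>r<length ks. ks ! r \<in> {1..d} \<and>
            (\<forall>w\<in>set (as ! r). \<forall>l\<in>set w. l \<in> range LB \<or> l = LY (ks ! r)) \<and>
            Esum \<phi> X u d (as ! r) = 0) \<and>
        (\<forall>r. Suc r < length ks \<longrightarrow> ks ! r \<noteq> ks ! Suc r)
      \<longrightarrow> Esum \<phi> X u d (map concat (product_lists as)) = 0)"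

text \<open>A surjective unital *-homomorphism \<open>\<beta> : Pol(O_d^+) \<rightarrow> \<B>\<close> is the same as a family
  \<open>u_{ij} = \<beta>(u_{ij})\<close> of self-adjoint elements satisfying the defining relations of
  \<open>Pol(O_d^+)\<close> and generating \<open>\<B>\<close> (universal property).\<close>
definition orth_quantum_matrix :: "nat \<Rightarrow> (nat \<Rightarrow> nat \<Rightarrow> 'b::star_algebra) \<Rightarrow> bool" where
  "orth_quantum_matrix d u \<longleftrightarrow>
     (\<forall>i\<in>{1..d}. \<forall>j\<in>{1..d}. sadj (u i j) = u i j) \<and>
     (\<forall>j\<in>{1..d}. \<forall>j'\<in>{1..d}. (\<Sum>i\<in>{1..d}. u i j * u i j') = (if j = j' then 1 else 0)) \<and>
     (\<forall>i\<in>{1..d}. \<forall>i'\<in>{1..d}. (\<Sum>j\<in>{1..d}. u i j * u i' j) = (if i = i' then 1 else 0)) \<and>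
     (\<forall>b. b \<in> salg {u i j | i j. i \<in> {1..d} \<and> j \<in> {1..d}})"

end

theory Submission
  imports Defs
begin

text \<open>
  After centring the \<open>X_i\<close>, let \<open>m(k)\<close> be their moments and \<open>s = m(2)\<close>. They are semicircular iff
  \<open>m(k+1) = s \<Sum>_{q<k} m(q) m(k-1-q)\<close> for all \<open>k\<close>. Otherwise let \<open>N \<ge> 2\<close> be the least \<open>k\<close> where
  this fails, with defect \<open>c \<noteq> 0\<close>. By freeness, mixed moments of length at most \<open>N + 1\<close> obey the
  Schwinger-Dyson equation of a free semicircular family, up to the defect \<open>c\<close> for the words
  \<open>X_i^(N+1)\<close>. Orthogonality of \<open>u\<close> preserves that equation, so \<open>E(Y_j1 \<cdots> Y_jn)\<close> is the
  semicircular moment for \<open>n \<le> N\<close>, and for \<open>n = N + 1\<close> it has the additional term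
  \<open>c \<Sum>_i u_{i,j1} \<cdots> u_{i,jn}\<close>. For the word \<open>Y_j Y_j'^(N-1) Y_j''\<close> with \<open>j \<noteq> j'\<close>, freeness with
  amalgamation yields the semicircular moment alone, hence
  \<open>\<Sum>_i u_{i,j} u_{i,j'}^(N-1) u_{i,j''} = 0\<close> for all \<open>j''\<close>. Multiplying by \<open>u_{k,j''}\<close> and summing
  over \<open>j''\<close> gives \<open>u_{k,j} u_{k,j'}^(N-1) = 0\<close>. A self-adjoint operator has the same kernel as its
  positive powers, so \<open>u_{k,j'} u_{k,j} = 0\<close>, and \<open>\<Sum>_l u_{k,l}^2 = 1\<close> turns this into
  \<open>u_{k,j}^2 = u_{k,j}^4\<close>.
\<close>

subsection \<open>Non-crossing partitions with blocks of size at most two\<close>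

text \<open>Arbitrary sets of points are allowed because removing the block of the point 0 leaves
  two intervals, of which at most one is initial up to relabelling.\<close>

definition NC_on :: "nat set \<Rightarrow> nat set set set" where
  "NC_on A = {P. partition_on A P \<and> noncrossing P}"

text \<open>For \<open>A = {..<n}\<close> this is the \<open>n\<close>-th moment of a single
  variable whose free cumulants are \<open>c\<close>.\<close>

definition NC_sum :: "(nat \<Rightarrow> complex) \<Rightarrow> nat set \<Rightarrow> complex" where
  "NC_sum c A = (\<Sum>P\<in>NC_on A. \<Prod>B\<in>P. c (card B))"

lemma noncrossingD:
  assumes "noncrossing P" "B1 \<in> P" "B2 \<in> P" "B1 \<noteq> B2"
    "a < b" "b < c" "c < e" "a \<in> B1" "c \<in> B1" "b \<in> B2" "e \<in> B2"
  shows False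
proof -
  have "\<exists>a b c e. a < b \<and> b < c \<and> c < e \<and> a \<in> B1 \<and> c \<in> B1 \<and> b \<in> B2 \<and> e \<in> B2"
    using assms(5-) by (intro exI conjI)
  then show False
    using assms(1)[unfolded noncrossing_def, rule_format, OF assms(2-4)] by (rule notE[rotated])
qed

lemma NC_eq_NC_on: "NC m = NC_on {..<m}"
  by (simp add: NC_def NC_on_def)

lemma NC_on_subset_Pow: "NC_on A \<subseteq> Pow (Pow A)"
  by (auto simp: NC_on_def partition_on_def)

lemma finite_NC_on: "finite A \<Longrightarrow> finite (NC_on A)"
  by (rule finite_subset[OF NC_on_subset_Pow]) auto

lemma NC_on_block_subset: "P \<in> NC_on A \<Longrightarrow> B \<in> P \<Longrightarrow> B \<subseteq> A"
  using NC_on_subset_Pow by auto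

lemma NC_on_finite: "P \<in> NC_on A \<Longrightarrow> finite A \<Longrightarrow> finite P"
  using NC_on_subset_Pow[of A] by (meson PowD finite_Pow_iff finite_subset subsetD)

lemma NC_on_empty: "NC_on {} = {{}}"
  by (auto simp: NC_on_def partition_on_empty noncrossing_def)

lemma NC_sum_empty: "NC_sum c {} = 1"
  by (simp add: NC_sum_def NC_on_empty)

text \<open>A strictly monotone map also reflects the order, so a crossing in the image would pull
  back to a crossing of \<open>P\<close>.\<close>

lemma NC_on_image:
  assumes f: "strict_mono_on A f" and P: "P \<in> NC_on A"
  shows "(`) f ` P \<in> NC_on (f ` A)"
proof -
  have inj: "inj_on f A" using f by (rule strict_mono_on_imp_inj_on)
  have sub: "B \<subseteq> A" if "B \<in> P" for B using NC_on_block_subset[OF P that] .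
  have part: "partition_on A P" using P by (simp add: NC_on_def)
  have ne: "{} \<notin> (`) f ` P" using partition_onD3[OF part] by auto
  have "partition_on (f ` A) ((`) f ` P)"
    using partition_on_inj_image[OF part inj] ne by simp
  moreover have "noncrossing ((`) f ` P)"
    unfolding noncrossing_def
  proof (intro ballI impI notI, elim imageE exE conjE)
    fix B1 B2 C1 C2 a b c e
    assume *: "C1 \<in> P" "C2 \<in> P" "B1 = f ` C1" "B2 = f ` C2" "B1 \<noteq> B2"
      "a < b" "b < c" "c < e" "a \<in> B1" "c \<in> B1" "b \<in> B2" "e \<in> B2"
    then obtain a' b' c' e' where e: "a = f a'" "b = f b'" "c = f c'" "e = f e'"
      "a' \<in> C1" "c' \<in> C1" "b' \<in> C2" "e' \<in> C2" by blast
    have A: "a' \<in> A" "b' \<in> A" "c' \<in> A" "e' \<in> A"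
      using e sub[OF *(1)] sub[OF *(2)] by blast+
    have "a' < b'" "b' < c'" "c' < e'"
      using strict_mono_on_less[OF f] A *(6-8) e(1-4) by simp_all
    moreover have "noncrossing P" using P by (simp add: NC_on_def)
    moreover have "C1 \<noteq> C2" using *(3-5) by blast
    ultimately show False using noncrossingD[OF _ *(1,2)] e(5-8) by metis
  qed
  ultimately show ?thesis by (simp add: NC_on_def)
qed

lemma NC_sum_image:
  assumes f: "strict_mono_on A f"
  shows "NC_sum c (f ` A) = NC_sum c A"
proof -
  define g where "g = inv_into A f"
  have inj: "inj_on f A" using f by (rule strict_mono_on_imp_inj_on)
  have gf: "g (f x) = x" if "x \<in> A" for x using inj that by (simp add: g_def)
  have g: "strict_mono_on (f ` A) g"
    by (rule strict_mono_onI) (use strict_mono_on_less[OF f] gf in auto)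
  have gA: "g ` f ` A = A" using gf by force
  have imgf: "g ` f ` B = B" if "B \<subseteq> A" for B using gf that by force
  have imfg: "f ` g ` B = B" if "B \<subseteq> f ` A" for B using gf that by force
  have 1: "(`) g ` ((`) f ` P) = P" if "P \<in> NC_on A" for P
    using imgf NC_on_block_subset[OF that] by (force simp: image_image)
  have 2: "(`) f ` ((`) g ` P) = P" if "P \<in> NC_on (f ` A)" for P
    using imfg NC_on_block_subset[OF that] by (force simp: image_image)
  have bij: "bij_betw ((`) ((`) f)) (NC_on A) (NC_on (f ` A))"
    by (rule bij_betw_byWitness[where f' = "(`) ((`) g)"])
      (use 1 2 NC_on_image[OF f] NC_on_image[OF g] gA in auto)
  have "(\<Prod>B\<in>(`) f ` P. c (card B)) = (\<Prod>B\<in>P. c (card B))" if "P \<in> NC_on A" for P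
  proof -
    have "inj_on ((`) f) P"
      using NC_on_block_subset[OF that] by (metis imgf inj_onI)
    moreover have "card (f ` B) = card B" if "B \<in> P" for B
      using NC_on_block_subset[OF \<open>P \<in> NC_on A\<close> that] inj by (meson card_image inj_on_subset)
    ultimately show ?thesis by (simp add: prod.reindex)
  qed
  then show ?thesis
    unfolding NC_sum_def sum.reindex_bij_betw[OF bij, symmetric] by (intro sum.cong) auto
qed

lemma NC_sum_interval: "NC_sum c {a..<b} = NC_sum c {..<b - a}"
proof (cases "a \<le> b")
  case True
  have "{a..<b} = (+) a ` {..<b - a}"
    using True by (auto simp: image_iff lessThan_atLeast0)
  then show ?thesis by (simp add: NC_sum_image strict_mono_on_def)
qed auto

text \<open>The block \<open>{0, b}\<close> separates the points between 0 and \<open>b\<close> from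
  those beyond \<open>b\<close>, since a block meeting both ranges would cross it. The case
  \<open>b = 0\<close> is the singleton block, with an empty first range.\<close>

lemma bij_betw_NC_on_first_block:
  assumes b: "b \<le> m"
  shows "bij_betw (\<lambda>(Q, R). insert {0, b} (Q \<union> R))
    (NC_on {1..<b} \<times> NC_on {Suc b..<Suc m}) {P \<in> NC_on {..<Suc m}. {0, b} \<in> P}"
proof -
  let ?A1 = "{1..<b}" and ?A2 = "{Suc b..<Suc m}"
  have dis: "B \<noteq> {}" "B \<subseteq> A" if "B \<in> P" "P \<in> NC_on A" for B P A
    using that by (auto simp: NC_on_def partition_on_def)
  \<comment> \<open>The inverse map sorts the blocks by the interval containing them. Blocks are
    nonempty, so none lies in both intervals.\<close>
  have 1: "\<forall>a\<in>NC_on ?A1 \<times> NC_on ?A2.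
       ((\<lambda>P. (P \<inter> Pow ?A1, P \<inter> Pow ?A2)) ((\<lambda>(Q, R). insert {0, b} (Q \<union> R)) a)) = a"
  proof (clarify)
    fix Q R assume Q: "Q \<in> NC_on ?A1" and R: "R \<in> NC_on ?A2"
    have "\<not> {0, b} \<subseteq> ?A1" "\<not> {0, b} \<subseteq> ?A2" by auto
    moreover have "B \<subseteq> ?A1 \<and> \<not> B \<subseteq> ?A2" if B: "B \<in> Q" for B
    proof -
      obtain x where "x \<in> B" using dis(1)[OF B Q] by blast
      moreover have "x \<in> ?A1 \<Longrightarrow> x \<notin> ?A2" by simp
      ultimately show ?thesis using dis(2)[OF B Q] by blast
    qed
    moreover have "B \<subseteq> ?A2 \<and> \<not> B \<subseteq> ?A1" if B: "B \<in> R" for B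
    proof -
      obtain x where "x \<in> B" using dis(1)[OF B R] by blast
      moreover have "x \<in> ?A1 \<Longrightarrow> x \<notin> ?A2" by simp
      ultimately show ?thesis using dis(2)[OF B R] by blast
    qed
    ultimately show "insert {0, b} (Q \<union> R) \<inter> Pow ?A1 = Q \<and> insert {0, b} (Q \<union> R) \<inter> Pow ?A2 = R"
      by blast
  qed
  have split: "B = {0, b} \<or> B \<subseteq> ?A1 \<or> B \<subseteq> ?A2"
    if P: "P \<in> NC_on {..<Suc m}" "{0, b} \<in> P" and B: "B \<in> P" for P B
  proof (rule ccontr)
    assume c: "\<not> ?thesis"
    then have ne: "B \<noteq> {0, b}" by auto
    have disj: "B \<inter> {0, b} = {}"
      using P B ne by (auto simp: NC_on_def partition_on_def pairwise_def disjnt_def)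
    have sub: "B \<subseteq> {..<Suc m}" using dis[OF B P(1)] by auto
    obtain x where x: "x \<in> B" "x \<notin> ?A1" using c by blast
    obtain y where y: "y \<in> B" "y \<notin> ?A2" using c by blast
    have "0 \<notin> B" "b \<notin> B" using disj by auto
    then have "x \<noteq> 0" "x \<noteq> b" "y \<noteq> 0" "y \<noteq> b" using x(1) y(1) by metis+
    then have "0 < y" "y < b" "b < x" using x y sub by auto
    moreover have "noncrossing P" using P by (simp add: NC_on_def)
    ultimately show False
      using noncrossingD[OF _ P(2) B ne[symmetric], of 0 y b x] x y by simp
  qed
  have 2: "\<forall>P\<in>{P \<in> NC_on {..<Suc m}. {0, b} \<in> P}.
       (\<lambda>(Q, R). insert {0, b} (Q \<union> R)) (P \<inter> Pow ?A1, P \<inter> Pow ?A2) = P"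
    using split by blast
  have 3: "(\<lambda>(Q, R). insert {0, b} (Q \<union> R)) ` (NC_on ?A1 \<times> NC_on ?A2)
    \<subseteq> {P \<in> NC_on {..<Suc m}. {0, b} \<in> P}"
  proof (rule image_subsetI, clarify, intro conjI)
    fix Q R assume Q: "Q \<in> NC_on ?A1" and R: "R \<in> NC_on ?A2"
    show "{0, b} \<in> insert {0, b} (Q \<union> R)" by (rule insertI1)
    have pQ: "partition_on ?A1 Q" and pR: "partition_on ?A2 R"
      and nQ: "noncrossing Q" and nR: "noncrossing R"
      using Q R by (auto simp: NC_on_def)
    let ?P = "insert {0, b} (Q \<union> R)"
    have sQ: "\<And>B x. B \<in> Q \<Longrightarrow> x \<in> B \<Longrightarrow> 0 < x \<and> x < b" using dis[OF _ Q] by fastforce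
    have sR: "\<And>B x. B \<in> R \<Longrightarrow> x \<in> B \<Longrightarrow> b < x \<and> x \<le> m" using dis[OF _ R] by fastforce
    have cls: "B = {0, b} \<and> (x = 0 \<or> x = b) \<or> B \<in> Q \<and> 0 < x \<and> x < b \<or> B \<in> R \<and> b < x"
      if "B \<in> ?P" "x \<in> B" for B x
      using that sQ[of B x] sR[of B x] by blast
    have "partition_on {..<Suc m} ?P"
    proof (rule partition_onI)
      have "\<Union>?P = {0, b} \<union> ?A1 \<union> ?A2"
        using pQ pR by (auto simp: partition_on_def)
      also have "\<dots> = {..<Suc m}" using b by auto
      finally show "\<Union>?P = {..<Suc m}" .
      show "{} \<notin> ?P" using pQ pR by (auto simp: partition_on_def)
      fix p q assume pq: "p \<in> ?P" "q \<in> ?P" "p \<noteq> q"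
      have dQ: "disjoint Q" and dR: "disjoint R" using pQ pR by (auto simp: partition_on_def)
      show "disjnt p q"
      proof (rule ccontr)
        assume nd: "\<not> disjnt p q"
        then obtain x where x: "x \<in> p" "x \<in> q" by (auto simp: disjnt_iff)
        have "(p \<in> Q \<and> q \<in> Q) \<or> (p \<in> R \<and> q \<in> R)"
          using cls[OF pq(1) x(1)] cls[OF pq(2) x(2)] pq(3) by (elim disjE conjE) simp_all
        then show False using nd pq(3) pairwiseD[OF dQ] pairwiseD[OF dR] by metis
      qed
    qed
    moreover have "noncrossing ?P"
      unfolding noncrossing_def
    proof (intro ballI impI notI, elim exE conjE)
      fix B1 B2 x y z t
      assume *: "B1 \<in> ?P" "B2 \<in> ?P" "B1 \<noteq> B2" "x < y" "y < z" "z < t"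
        "x \<in> B1" "z \<in> B1" "y \<in> B2" "t \<in> B2"
      have "(B1 \<in> Q \<and> B2 \<in> Q) \<or> (B1 \<in> R \<and> B2 \<in> R)"
      proof -
        consider "B1 = {0, b}" | "B1 \<in> Q" | "B1 \<in> R" using *(1) by blast
        then show ?thesis
        proof cases
          case 1
          then have "x = 0 \<or> x = b" "z = 0 \<or> z = b" using *(7,8) by simp_all
          then have "z = b" using *(4,5) by linarith
          moreover have "B2 \<in> Q \<or> B2 \<in> R" using 1 *(2,3) by blast
          ultimately show ?thesis using sQ[of B2 t] sR[of B2 y] *(5,6,9,10) by linarith
        next
          case 2
          then have "0 < y" "y < b" using sQ[of B1 x] sQ[of B1 z] *(4,5,7,8) by linarith+
          then show ?thesis using 2 cls[OF *(2) *(9)] by linarith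
        next
          case 3
          then have "b < y" using sR[of B1 x] *(4,7) by linarith
          then show ?thesis using 3 cls[OF *(2) *(9)] by linarith
        qed
      qed
      then show False 
        using noncrossingD[OF nQ _ _ *(3-10)] noncrossingD[OF nR _ _ *(3-10)] by blast
    qed
    ultimately show "?P \<in> NC_on {..<Suc m}" by (simp add: NC_on_def)
  qed
  have 4: "(\<lambda>P. (P \<inter> Pow ?A1, P \<inter> Pow ?A2)) ` {P \<in> NC_on {..<Suc m}. {0, b} \<in> P}
    \<subseteq> NC_on ?A1 \<times> NC_on ?A2"
  proof (rule image_subsetI, intro SigmaI)
    fix P assume "P \<in> {P \<in> NC_on {..<Suc m}. {0, b} \<in> P}"
    then have P: "P \<in> NC_on {..<Suc m}" "{0, b} \<in> P" by auto
    have cov: "\<exists>B\<in>P. x \<in> B" if "x \<le> m" for x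
      using P that by (auto simp: NC_on_def partition_on_def)
    have P': "noncrossing P" "disjoint P" "{} \<notin> P"
      using P by (simp_all add: NC_on_def partition_on_def)
    have nc: "noncrossing (P \<inter> Z)" for Z
      using P'(1) unfolding noncrossing_def by (meson IntD1)
    have dj: "disjoint (P \<inter> Z)" for Z
      using P'(2) by (auto intro: pairwise_subset)
    have "\<Union>(P \<inter> Pow ?A1) = ?A1"
    proof (intro equalityI subsetI)
      fix x assume x: "x \<in> ?A1"
      then obtain B where B: "B \<in> P" "x \<in> B" using cov[of x] b by auto
      have "B \<noteq> {0, b}" "\<not> B \<subseteq> ?A2" using x B by auto
      then show "x \<in> \<Union>(P \<inter> Pow ?A1)" using split[OF P B(1)] B by auto
    qed auto
    then show "P \<inter> Pow ?A1 \<in> NC_on ?A1"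
      using nc dj P'(3) by (simp add: NC_on_def partition_on_def)
    have "\<Union>(P \<inter> Pow ?A2) = ?A2"
    proof (intro equalityI subsetI)
      fix x assume x: "x \<in> ?A2"
      then obtain B where B: "B \<in> P" "x \<in> B" using cov[of x] b by auto
      have "B \<noteq> {0, b}" "\<not> B \<subseteq> ?A1" using x B by auto
      then show "x \<in> \<Union>(P \<inter> Pow ?A2)" using split[OF P B(1)] B by auto
    qed auto
    then show "P \<inter> Pow ?A2 \<in> NC_on ?A2"
      using nc dj P'(3) by (simp add: NC_on_def partition_on_def)
  qed
  show ?thesis using 1 2 3 4 by (rule bij_betw_byWitness)
qed

text \<open>When all cumulants beyond the second vanish, only partitions whose first block is
  \<open>{0}\<close> or \<open>{0, b}\<close> contribute, and such a block splits the other points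
  into two independent intervals.\<close>

lemma NC_sum_Suc:
  assumes c: "\<And>k. k \<ge> 3 \<Longrightarrow> c k = 0"
  shows "NC_sum c {..<Suc m} =
    c 1 * NC_sum c {..<m} + c 2 * (\<Sum>q<m. NC_sum c {..<q} * NC_sum c {..<m - 1 - q})"
proof -
  let ?w = "\<lambda>P. \<Prod>B\<in>P. c (card B)"
  let ?S = "\<lambda>b. {P \<in> NC_on {..<Suc m}. {0, b} \<in> P}"
  have part: "(\<Sum>P\<in>?S b. ?w P) = c (card {0, b}) * (NC_sum c {..<b - 1} * NC_sum c {..<m - b})"
    if b: "b \<le> m" for b
  proof -
    have "(\<Sum>P\<in>?S b. ?w P) =
      (\<Sum>(Q, R)\<in>NC_on {1..<b} \<times> NC_on {Suc b..<Suc m}. ?w (insert {0, b} (Q \<union> R)))"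
      using sum.reindex_bij_betw[OF bij_betw_NC_on_first_block[OF b], of ?w]
      by (simp add: case_prod_unfold)
    also have "\<dots> = (\<Sum>(Q, R)\<in>NC_on {1..<b} \<times> NC_on {Suc b..<Suc m}.
        c (card {0, b}) * (?w Q * ?w R))"
    proof (rule sum.cong[OF refl], clarify)
      fix Q R assume Q: "Q \<in> NC_on {1..<b}" and R: "R \<in> NC_on {Suc b..<Suc m}"
      have fin: "finite Q" "finite R" using Q R NC_on_finite by blast+
      have sQ: "\<forall>B\<in>Q. B \<subseteq> {1..<b} \<and> B \<noteq> {}" and sR: "\<forall>B\<in>R. B \<subseteq> {Suc b..<Suc m} \<and> B \<noteq> {}"
        using NC_on_block_subset[OF Q] NC_on_block_subset[OF R] Q R
        by (auto simp: NC_on_def partition_on_def)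
      have "Q \<inter> R = {}"
      proof (rule ccontr)
        assume "Q \<inter> R \<noteq> {}"
        then obtain B where "B \<in> Q" "B \<in> R" by auto
        moreover from this obtain x where "x \<in> B" using sQ by blast
        ultimately have "x \<in> {1..<b}" "x \<in> {Suc b..<Suc m}" using sQ sR by blast+
        then show False by simp
      qed
      moreover have "{0, b} \<notin> Q \<union> R" using sQ sR by fastforce
      ultimately show "?w (insert {0, b} (Q \<union> R)) = c (card {0, b}) * (?w Q * ?w R)"
        using fin by (simp add: prod.union_disjoint)
    qed
    also have "\<dots> = c (card {0, b}) * (NC_sum c {1..<b} * NC_sum c {Suc b..<Suc m})"
      unfolding sum.cartesian_product[symmetric] NC_sum_def
      unfolding sum_product unfolding sum_distrib_left by (rule refl)
    finally show ?thesis by (simp add: NC_sum_interval)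
  qed
  have fin: "finite (NC_on {..<Suc m})" by (simp add: finite_NC_on)
  have "NC_sum c {..<Suc m} = (\<Sum>P\<in>(\<Union>b\<in>{..m}. ?S b). ?w P)"
    unfolding NC_sum_def
  proof (rule sum.mono_neutral_right[OF fin], blast, clarify)
    fix P assume P: "P \<in> NC_on {..<Suc m}" and n: "P \<notin> (\<Union>b\<in>{..m}. ?S b)"
    have "0 \<in> \<Union>P" using P by (auto simp: NC_on_def partition_on_def)
    then obtain V where V: "V \<in> P" "0 \<in> V" by auto
    have Vs: "V \<subseteq> {..<Suc m}" using NC_on_block_subset[OF P V(1)] .
    have nV: "V \<noteq> {0, b}" if "b \<le> m" for b using n P V that by auto
    have finV: "finite V" using Vs finite_subset by blast
    obtain y where y: "y \<in> V" "y \<noteq> 0" using nV[of 0] V by auto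
    have "y \<le> m" using y Vs by auto
    then obtain z where z: "z \<in> V" "z \<noteq> 0" "z \<noteq> y" using nV[of y] V y by blast
    have "card {0, y, z} \<le> card V" using V y z finV by (intro card_mono) auto
    then have "3 \<le> card V" using y z by simp
    then show "?w P = 0"
      using V(1) c NC_on_finite[OF P] by (auto intro!: prod_zero)
  qed
  also have "\<dots> = (\<Sum>b\<in>{..m}. \<Sum>P\<in>?S b. ?w P)"
  proof (rule sum.UNION_disjoint)
    show "\<forall>i\<in>{..m}. \<forall>j\<in>{..m}. i \<noteq> j \<longrightarrow> ?S i \<inter> ?S j = {}"
    proof (intro ballI impI equals0I)
      fix i j P assume ij: "i \<noteq> j" and "P \<in> ?S i \<inter> ?S j"
      then have P: "disjoint P" "{0, i} \<in> P" "{0, j} \<in> P"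
        by (auto simp: NC_on_def partition_on_def)
      have "{0, i} \<noteq> {0, j}" using ij by (auto simp: doubleton_eq_iff)
      then have "disjnt {0, i} {0, j}" using pairwiseD[OF P(1)] P by metis
      then show False by (simp add: disjnt_def)
    qed
  qed (use fin in auto)
  also have "\<dots> = (\<Sum>b\<le>m. c (card {0, b}) * (NC_sum c {..<b - 1} * NC_sum c {..<m - b}))"
    by (intro sum.cong refl part) auto
  \<comment> \<open>For \<open>b = 0\<close> the truncated \<open>b - 1\<close> is 0 and the first
    factor is the empty sum 1. For \<open>b > 0\<close> the index is \<open>q = b - 1\<close>, the
    number of enclosed points.\<close>
  also have "\<dots> = c 1 * NC_sum c {..<m} +
      (\<Sum>q<m. c 2 * (NC_sum c {..<q} * NC_sum c {..<m - Suc q}))"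
    by (simp add: sum.atMost_shift NC_sum_empty numeral_2_eq_2)
  finally show ?thesis by (simp add: sum_distrib_left)
qed

lemma nths_replicate: "nths (replicate m x) B = replicate (card (B \<inter> {..<m})) x"
proof (rule replicate_eqI)
  show "length (nths (replicate m x) B) = card (B \<inter> {..<m})"
    by (simp add: length_nths) (rule arg_cong[where f = card], auto)
  show "\<And>y. y \<in> set (nths (replicate m x) B) \<Longrightarrow> y = x"
    using set_nths_subset[of "replicate m x" B] by fastforce
qed

lemma prod_list_replicate_power: "prod_list (replicate n (x::'a::monoid_mult)) = x ^ n"
  by (induction n) auto

text \<open>The recursion is the one satisfied by the moments of the cumulant sequence
  \<open>\<mu>, \<sigma>, 0, 0, ...\<close>. The moment-cumulant formula can be solved for the
  cumulant of highest order, so these are the cumulants of \<open>x\<close>.\<close>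

lemma free_cumulants_eq_zero:
  assumes \<kappa>: "free_cumulants \<phi> \<kappa>" and one: "\<phi> 1 = 1"
    and rec: "\<And>k. \<phi> (x ^ Suc k) =
      \<mu> * \<phi> (x ^ k) + \<sigma> * (\<Sum>q<k. \<phi> (x ^ q) * \<phi> (x ^ (k - 1 - q)))"
    and n: "n \<ge> 3"
  shows "\<kappa> (replicate n x) = 0"
proof -
  define c :: "nat \<Rightarrow> complex" where "c k = (if k = 1 then \<mu> else if k = 2 then \<sigma> else 0)" for k
  have N: "NC_sum c {..<k} = \<phi> (x ^ k)" for k
  proof (induction k rule: less_induct)
    case (less k)
    show ?case
    proof (cases k)
      case 0 then show ?thesis by (simp add: NC_sum_empty one)
    next
      case (Suc j)
      have "NC_sum c {..<Suc j} = c 1 * NC_sum c {..<j} +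
          c 2 * (\<Sum>q<j. NC_sum c {..<q} * NC_sum c {..<j - 1 - q})"
        by (rule NC_sum_Suc) (simp add: c_def)
      also have "\<dots> = \<phi> (x ^ Suc j)"
        unfolding rec using Suc by (simp add: less c_def)
      finally show ?thesis using Suc by simp
    qed
  qed
  have "\<kappa> (replicate k x) = c k" if "k \<ge> 1" for k
    using that
  proof (induction k rule: less_induct)
    case (less k)
    \<comment> \<open>The one-block partition carries the cumulant of order \<open>k\<close>. Every
      other partition has only blocks of fewer than \<open>k\<close> points, which the induction
      hypothesis covers.\<close>
    let ?T = "{{..<k}}"
    have ne: "{..<k} \<noteq> {}" using less.prems by (auto simp: lessThan_empty_iff)
    have T: "?T \<in> NC_on {..<k}"
      using partition_on_space[OF ne] by (auto simp: NC_on_def noncrossing_def)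
    have fin: "finite (NC_on {..<k})" by (simp add: finite_NC_on)
    have blocks: "\<kappa> (nths (replicate k x) B) = c (card B)"
      if P: "P \<in> NC_on {..<k} - {?T}" and B: "B \<in> P" for P B
    proof -
      have Bs: "B \<subseteq> {..<k}" using P B NC_on_block_subset by blast
      have Bne: "B \<noteq> {}" using P B by (auto simp: NC_on_def partition_on_def)
      have "B \<noteq> {..<k}"
      proof
        assume e: "B = {..<k}"
        have "C = B" if "C \<in> P" for C
        proof (rule ccontr)
          assume "C \<noteq> B"
          then have "disjnt C B" using P B that by (auto simp: NC_on_def partition_on_def pairwise_def)
          moreover have "C \<subseteq> {..<k}" "C \<noteq> {}"
            using P that by (auto simp: NC_on_def partition_on_def)
          ultimately show False using e by (auto simp: disjnt_def)
        qed
        then have "P = {B}" using B by blast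
        then show False using P e by simp
      qed
      then have lt: "card B < k" using Bs by (metis card_lessThan finite_lessThan psubsetI psubset_card_mono)
      have "finite B" using Bs finite_subset by blast
      then have "1 \<le> card B" using Bne by (simp add: Suc_le_eq card_gt_0_iff)
      then show ?thesis using less.IH[OF lt] Bs by (simp add: nths_replicate Int_absorb2)
    qed
    have "\<phi> (x ^ k) = (\<Sum>P\<in>NC_on {..<k}. \<Prod>B\<in>P. \<kappa> (nths (replicate k x) B))"
      using \<kappa> unfolding free_cumulants_def
      by (metis length_replicate prod_list_replicate_power NC_eq_NC_on)
    also have "\<dots> = \<kappa> (replicate k x) +
        (\<Sum>P\<in>NC_on {..<k} - {?T}. \<Prod>B\<in>P. \<kappa> (nths (replicate k x) B))"
      by (simp add: sum.remove[OF fin T])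
    also have "(\<Sum>P\<in>NC_on {..<k} - {?T}. \<Prod>B\<in>P. \<kappa> (nths (replicate k x) B)) =
        (\<Sum>P\<in>NC_on {..<k} - {?T}. \<Prod>B\<in>P. c (card B))"
      by (intro sum.cong prod.cong refl blocks)
    finally have 1: "\<phi> (x ^ k) = \<kappa> (replicate k x) +
        (\<Sum>P\<in>NC_on {..<k} - {?T}. \<Prod>B\<in>P. c (card B))" .
    have "\<phi> (x ^ k) = c k + (\<Sum>P\<in>NC_on {..<k} - {?T}. \<Prod>B\<in>P. c (card B))"
      unfolding N[symmetric] NC_sum_def by (simp add: sum.remove[OF fin T])
    with 1 show ?case by simp
  qed
  then show ?thesis using n by (simp add: c_def)
qed

subsection \<open>Mixed moments of a free family\<close>

lemma cscale_zero_left [simp]: "cscale 0 (x::'a::star_algebra) = 0"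
  using cscale_add_left[of 0 0 x] by simp

lemma cscale_zero_right [simp]: "cscale c (0::'a::star_algebra) = 0"
  using cscale_add_right[of c 0 "0::'a"] by simp

lemma cscale_minus_left: "cscale (- c) (x::'a::star_algebra) = - cscale c x"
  using cscale_add_left[of c "- c" x] by (simp add: minus_unique)

lemma cscale_diff_left: "cscale (c - e) x = cscale c x - cscale e (x::'a::star_algebra)"
  using cscale_add_left[of c "- e" x] by (simp add: cscale_minus_left)

lemma cscale_sum_right: "cscale c (\<Sum>i\<in>A. f i) = (\<Sum>i\<in>A. cscale c (f i :: 'a::star_algebra))"
  by (induction A rule: infinite_finite_induct) (auto simp: cscale_add_right)

lemma cscale_sum_left: "cscale (\<Sum>i\<in>A. f i) (x :: 'a::star_algebra) = (\<Sum>i\<in>A. cscale (f i) x)"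
  by (induction A rule: infinite_finite_induct) (auto simp: cscale_add_left)

lemma cscale_eq_0_iff: "cscale c (x::'a::star_algebra) = 0 \<longleftrightarrow> c = 0 \<or> x = 0"
  using cscale_cscale[of "inverse c" c x] by (cases "c = 0") (auto simp: cscale_one)

lemma salg_diff: "x \<in> salg S \<Longrightarrow> y \<in> salg S \<Longrightarrow> x - y \<in> salg S"
  using salg_add[OF _ salg_scale[of y S "-1"], of x]
  by (simp add: cscale_minus_left cscale_one)

lemma salg_power: "x \<in> salg S \<Longrightarrow> x ^ n \<in> salg S"
  by (induction n) (auto intro: salg.intros)

lemma salg_const: "cscale c 1 \<in> salg S"
  by (intro salg.intros)

lemma salg_subset: "S \<subseteq> salg T \<Longrightarrow> salg S \<subseteq> salg T"
proof
  fix x assume "S \<subseteq> salg T" "x \<in> salg S"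
  from this(2,1) show "x \<in> salg T" by induction (auto intro: salg.intros)
qed

locale ncp_space =
  fixes \<phi> :: "'a::star_algebra \<Rightarrow> complex"
  assumes ncps: "ncps \<phi>"
begin

lemma phi_add: "\<phi> (x + y) = \<phi> x + \<phi> y"
  and phi_scale: "\<phi> (cscale c x) = c * \<phi> x"
  and phi_one: "\<phi> 1 = 1"
  using ncps by (auto simp: ncps_def)

lemma phi_diff: "\<phi> (x - y) = \<phi> x - \<phi> y"
  by (metis add_diff_cancel_right' diff_add_cancel phi_add)

end

section \<open>The Schwinger-Dyson defect of products in a centred free family\<close>

locale centred_free_family = ncp_space \<phi> for \<phi> :: "'a::star_algebra \<Rightarrow> complex" +
  fixes d :: nat and X :: "nat \<Rightarrow> 'a" and m :: "nat \<Rightarrow> complex"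
  assumes free: "freely_independent \<phi> d X"
    and mom: "i \<in> {1..d} \<Longrightarrow> \<phi> (X i ^ k) = m k"
    and centred: "m 1 = 0"
begin

text \<open>The triple \<open>(a, p, c)\<close> stands for the polynomial \<open>X\<^sub>a\<^sup>p - c\<close>, a list of triples for their
  product. Then \<open>sd a x its\<close> is \<open>(\<phi> \<otimes> \<phi>)((x \<otimes> 1) \<cdot> \<partial>\<^sub>a its)\<close>, where \<open>\<partial>\<^sub>a\<close> is the free difference
  quotient.\<close>

fun factor :: "nat \<times> nat \<times> complex \<Rightarrow> 'a" where
  "factor (a, p, c) = X a ^ p - cscale c 1"

definition ev :: "(nat \<times> nat \<times> complex) list \<Rightarrow> 'a" where
  "ev its = prod_list (map factor its)"

fun sd :: "nat \<Rightarrow> 'a \<Rightarrow> (nat \<times> nat \<times> complex) list \<Rightarrow> complex" where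
  "sd a x [] = 0"
| "sd a x ((b, p, c) # its) =
    (if b = a then \<Sum>q<p. \<phi> (x * X a ^ q) * \<phi> (X a ^ (p - 1 - q) * ev its) else 0) +
    sd a (x * factor (b, p, c)) its"

text \<open>The failure of the Schwinger-Dyson equation \<open>\<phi>(X\<^sub>a P) = s (\<phi>
  \<otimes> \<phi>)(\<partial>\<^sub>a P)\<close>, which a free semicircular family of variance
  \<open>s\<close> satisfies.\<close>

definition sd_defect :: "complex \<Rightarrow> nat \<Rightarrow> (nat \<times> nat \<times> complex) list \<Rightarrow> complex" where
  "sd_defect s a its = \<phi> (X a * ev its) - s * sd a 1 its"

definition letters :: "nat list \<Rightarrow> (nat \<times> nat \<times> complex) list" where
  "letters w = map (\<lambda>b. (b, 1, 0)) w"

definition deg :: "(nat \<times> nat \<times> complex) list \<Rightarrow> nat" where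
  "deg its = sum_list (map (\<lambda>(b, p, c). p) its)"

lemma ev_simps [simp]: "ev [] = 1" "ev (i # its) = factor i * ev its"
  "ev (its @ its') = ev its * ev its'"
  by (simp_all add: ev_def)

lemma deg_simps [simp]: "deg [] = 0" "deg ((b, p, c) # its) = p + deg its"
  "deg (its @ its') = deg its + deg its'"
  by (simp_all add: deg_def)

declare factor.simps [simp del]

lemma factor_zero: "factor (b, p, 0) = X b ^ p"
  by (simp add: factor.simps)

lemma sd_add: "sd a (x + y) its = sd a x its + sd a y its"
proof (induction its arbitrary: x y)
  case (Cons i its)
  obtain b p c where i: "i = (b, p, c)" by (cases i)
  show ?case by (simp add: i Cons distrib_right phi_add sum.distrib)
qed simp

lemma sd_scale: "sd a (cscale e x) its = e * sd a x its"
proof (induction its arbitrary: x)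
  case (Cons i its)
  obtain b p c where i: "i = (b, p, c)" by (cases i)
  show ?case
    by (simp add: i Cons cscale_mult_left phi_scale sum_distrib_left distrib_left mult.assoc)
qed simp

lemma factor_shift: "factor (b, p, c) = factor (b, p, c') + cscale (c' - c) 1"
  by (simp add: factor.simps cscale_diff_left)

lemma ev_shift:
  "ev (pre @ (b, p, c) # post) = ev (pre @ (b, p, c') # post) + cscale (c' - c) (ev (pre @ post))"
  by (simp add: factor_shift[of b p c c'] algebra_simps cscale_mult_left cscale_mult_right)

text \<open>The free difference quotient kills constants, so by linearity a change of the constant
  in one factor contributes a multiple of the product with that factor deleted.\<close>

lemma sd_shift: "sd a x (pre @ (b, p, c) # post) =
    sd a x (pre @ (b, p, c') # post) + (c' - c) * sd a x (pre @ post)"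
proof (induction pre arbitrary: x)
  case Nil
  have "x * factor (b, p, c) = x * factor (b, p, c') + cscale (c' - c) x"
    by (simp add: factor_shift[of b p c c'] distrib_left cscale_mult_right)
  then show ?case by (simp add: sd_add sd_scale)
next
  case (Cons i pre)
  obtain b' p' e where i: "i = (b', p', e)" by (cases i)
  define A where "A y = \<phi> (y * ev (pre @ (b, p, c) # post))" for y
  define B where "B y = \<phi> (y * ev (pre @ (b, p, c') # post))" for y
  define C where "C y = \<phi> (y * ev (pre @ post))" for y
  have "A y = B y + (c' - c) * C y" for y
    unfolding A_def B_def C_def ev_shift[of pre b p c post c'] distrib_left cscale_mult_right
      phi_add phi_scale ..
  then have "(\<Sum>q<p'. f q * A (g q)) = (\<Sum>q<p'. f q * B (g q)) + (c' - c) * (\<Sum>q<p'. f q * C (g q))"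
    for f g
    by (simp add: sum.distrib sum_distrib_left distrib_left mult.left_commute)
  then show ?case
    unfolding i append_Cons sd.simps A_def[symmetric] B_def[symmetric] C_def[symmetric] Cons.IH
    by (simp add: distrib_left)
qed

lemma sd_defect_shift: "sd_defect s a (pre @ (b, p, c) # post) =
    sd_defect s a (pre @ (b, p, c') # post) + (c' - c) * sd_defect s a (pre @ post)"
  unfolding sd_defect_def sd_shift[of a 1 pre b p c post c'] ev_shift[of pre b p c post c']
  by (simp add: distrib_left cscale_mult_right phi_add phi_scale algebra_simps)

text \<open>A prefix sees the tail only through its value \<open>ev\<close> and its own
  \<open>sd\<close>.\<close>

lemma sd_append_cong:
  assumes "ev its = ev its'" "\<And>x. sd a x its = sd a x its'"
  shows "sd a x (pre @ its) = sd a x (pre @ its')"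
proof (induction pre arbitrary: x)
  case (Cons i pre)
  obtain b p c where i: "i = (b, p, c)" by (cases i)
  show ?case by (simp add: i Cons assms)
qed (simp add: assms)

lemma sd_Cons_Suc: "sd a x ((b, Suc p, 0) # its) = sd a x ((b, 1, 0) # (b, p, 0) # its)"
  by (simp add: sum.lessThan_Suc_shift factor_zero mult.assoc del: sum.lessThan_Suc)

lemma ev_Cons_Suc: "ev ((b, Suc p, 0) # its) = ev ((b, 1, 0) # (b, p, 0) # its)"
  by (simp add: factor_zero mult.assoc)

lemma ev_letters_replicate: "ev (letters (replicate p b) @ its) = ev ((b, p, 0) # its)"
  by (induction p) (simp_all add: letters_def factor_zero mult.assoc)

lemma sd_letters_replicate: "sd a x (letters (replicate p b) @ its) = sd a x ((b, p, 0) # its)"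
proof (induction p arbitrary: x)
  case 0 then show ?case by (simp add: letters_def factor_zero)
next
  case (Suc p)
  have "sd a x (letters (replicate (Suc p) b) @ its) =
      sd a x ([(b, 1, 0)] @ (letters (replicate p b) @ its))"
    by (simp add: letters_def)
  also have "\<dots> = sd a x ([(b, 1, 0)] @ ((b, p, 0) # its))"
    by (intro sd_append_cong ev_letters_replicate Suc)
  also have "\<dots> = sd a x ((b, Suc p, 0) # its)" by (simp only: sd_Cons_Suc append.simps)
  finally show ?case .
qed

text \<open>A constant in a factor can be traded, by \<open>sd_defect_shift\<close>, for the product
  without that factor, whose degree is no larger. The prefix \<open>v\<close> accumulates the
  letters of the powers already expanded.\<close>

lemma sd_defect_eq_zero_of_letters:
  assumes "\<And>w. set w \<subseteq> {1..d} \<Longrightarrow> length w < L \<Longrightarrow> sd_defect s a (letters w) = 0"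
    and "fst ` set its \<subseteq> {1..d}" "set v \<subseteq> {1..d}" "length v + deg its < L"
  shows "sd_defect s a (letters v @ its) = 0"
  using assms(2-)
proof (induction its arbitrary: v)
  case Nil then show ?case using assms(1) by simp
next
  case (Cons i its)
  obtain b p c where i: "i = (b, p, c)" by (cases i)
  have "ev (letters v @ (b, p, 0) # its) = ev (letters (v @ replicate p b) @ its)"
    using ev_letters_replicate[of p b its] by (simp add: letters_def mult.assoc)
  moreover have "sd a 1 (letters v @ (b, p, 0) # its) = sd a 1 (letters (v @ replicate p b) @ its)"
    using sd_append_cong[OF ev_letters_replicate sd_letters_replicate, of a 1 "letters v" p b its]
    by (simp add: letters_def)
  ultimately have "sd_defect s a (letters v @ (b, p, 0) # its) =
      sd_defect s a (letters (v @ replicate p b) @ its)"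
    by (simp add: sd_defect_def)
  also have "\<dots> = 0" by (rule Cons.IH) (use Cons.prems in \<open>auto simp: i\<close>)
  finally have "sd_defect s a (letters v @ (b, p, 0) # its) = 0" .
  moreover have "sd_defect s a (letters v @ its) = 0"
    by (rule Cons.IH) (use Cons.prems in \<open>auto simp: i\<close>)
  ultimately show ?case
    unfolding i sd_defect_shift[of s a "letters v" b p c its 0] by simp
qed

section \<open>Vanishing of the defect on centred alternating products\<close>

lemma phi_alternating:
  assumes "distinct_adj (map fst l)" "l \<noteq> []"
    and "\<And>k y. (k, y) \<in> set l \<Longrightarrow> k \<in> {1..d} \<and> y \<in> salg {X k} \<and> \<phi> y = 0"
  shows "\<phi> (prod_list (map snd l)) = 0"
proof -
  have "l ! r \<in> set l" if "r < length l" for r using that by simp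
  then have "\<forall>r<length (map fst l). map fst l ! r \<in> {1..d} \<and>
      map snd l ! r \<in> salg {X (map fst l ! r)} \<and> \<phi> (map snd l ! r) = 0"
    using assms(3) by (metis length_map nth_map prod.collapse)
  moreover have "\<forall>r. Suc r < length (map fst l) \<longrightarrow> map fst l ! r \<noteq> map fst l ! Suc r"
    using assms(1) unfolding distinct_adj_conv_nth .
  ultimately show ?thesis
    using free assms(2) unfolding freely_independent_def
    by (metis length_map map_is_Nil_conv)
qed

text \<open>The products to which freeness applies directly: the constant \<open>m p\<close> gives
  the factor \<open>X b ^ p - m p\<close> expectation zero.\<close>

definition centred_alt :: "(nat \<times> nat \<times> complex) list \<Rightarrow> bool" where
  "centred_alt its \<longleftrightarrow> distinct_adj (map fst its) \<and>
     (\<forall>(b, p, c)\<in>set its. b \<in> {1..d} \<and> c = m p)"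

lemma centred_alt_append:
  assumes "centred_alt (its @ its')" shows "centred_alt its" "centred_alt its'"
  using assms by (auto simp: centred_alt_def)

lemma factor_salg: "factor (b, p, c) \<in> salg {X b}"
  by (auto simp: factor.simps intro!: salg_diff salg_const intro: salg_power salg_gen)

lemma phi_factor: "b \<in> {1..d} \<Longrightarrow> \<phi> (factor (b, p, m p)) = 0"
  by (simp add: factor.simps phi_diff phi_scale phi_one mom)

definition tagged :: "(nat \<times> nat \<times> complex) list \<Rightarrow> (nat \<times> 'a) list" where
  "tagged its = map (\<lambda>i. (fst i, factor i)) its"

lemma tagged_simps:
  "map fst (tagged its) = map fst its" "map snd (tagged its) = map factor its"
  "tagged its = [] \<longleftrightarrow> its = []"
  by (auto simp: tagged_def)

lemma tagged_props:
  assumes "centred_alt its" "(k, y) \<in> set (tagged its)"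
  shows "k \<in> {1..d} \<and> y \<in> salg {X k} \<and> \<phi> y = 0"
  using assms phi_factor factor_salg by (fastforce simp: centred_alt_def tagged_def)

lemma phi_ev_centred: "centred_alt its \<Longrightarrow> its \<noteq> [] \<Longrightarrow> \<phi> (ev its) = 0"
  using phi_alternating[of "tagged its"] tagged_props[of its]
  by (auto simp: tagged_simps ev_def centred_alt_def)

lemma phi_centre:
  "\<phi> (x * y) = \<phi> ((x - cscale (\<phi> x) 1) * y) + \<phi> x * \<phi> y"
  "\<phi> (x * y) = \<phi> (x * (y - cscale (\<phi> y) 1)) + \<phi> x * \<phi> y"
  by (simp_all add: left_diff_distrib right_diff_distrib phi_diff cscale_mult_left
      cscale_mult_right phi_scale mult.commute)

text \<open>Split \<open>y\<close> into its centred part and a scalar: the first makes a longer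
  alternating centred product, the second a multiple of \<open>\<phi> (ev its)\<close>, and both
  vanish.\<close>

lemma phi_left_ev:
  assumes its: "centred_alt its" "its \<noteq> []" and y: "y \<in> salg {X b}" "b \<in> {1..d}" "b \<noteq> fst (hd its)"
  shows "\<phi> (y * ev its) = 0"
proof -
  let ?y = "y - cscale (\<phi> y) 1"
  have "\<phi> (prod_list (map snd ((b, ?y) # tagged its))) = 0"
  proof (rule phi_alternating)
    show "distinct_adj (map fst ((b, ?y) # tagged its))"
      using its y by (simp add: tagged_simps centred_alt_def distinct_adj_Cons hd_map)
    fix k z assume "(k, z) \<in> set ((b, ?y) # tagged its)"
    then show "k \<in> {1..d} \<and> z \<in> salg {X k} \<and> \<phi> z = 0"
      using y tagged_props[OF its(1)]
      by (auto simp: phi_diff phi_scale phi_one intro!: salg_diff salg_const)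
  qed simp
  then show ?thesis
    unfolding phi_centre(1)[of y] using phi_ev_centred[OF its] by (simp add: tagged_simps ev_def)
qed

lemma phi_ev_right:
  assumes its: "centred_alt its" "its \<noteq> []" and y: "y \<in> salg {X b}" "b \<in> {1..d}" "b \<noteq> fst (last its)"
  shows "\<phi> (ev its * y) = 0"
proof -
  let ?y = "y - cscale (\<phi> y) 1"
  have "\<phi> (prod_list (map snd (tagged its @ [(b, ?y)]))) = 0"
  proof (rule phi_alternating)
    show "distinct_adj (map fst (tagged its @ [(b, ?y)]))"
      using its y by (simp add: tagged_simps centred_alt_def distinct_adj_append_iff last_map)
    fix k z assume "(k, z) \<in> set (tagged its @ [(b, ?y)])"
    then show "k \<in> {1..d} \<and> z \<in> salg {X k} \<and> \<phi> z = 0"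
      using y tagged_props[OF its(1)]
      by (auto simp: phi_diff phi_scale phi_one intro!: salg_diff salg_const)
  qed simp
  then show ?thesis
    unfolding phi_centre(2)[of _ y] using phi_ev_centred[OF its] by (simp add: tagged_simps ev_def)
qed

text \<open>Each term of the difference quotient has as left leg a centred alternating product times
  a power of the next variable, which has expectation zero by \<open>phi_ev_right\<close>.\<close>

lemma sd_centred_prefix:
  assumes "centred_alt (pre @ its)" "pre \<noteq> []"
  shows "sd a (ev pre) its = 0"
  using assms
proof (induction its arbitrary: pre)
  case (Cons i its)
  obtain b p c where i: "i = (b, p, c)" by (cases i)
  have b: "b \<in> {1..d}" "b \<noteq> fst (last pre)" "centred_alt pre"
    using Cons.prems
    by (auto simp: i centred_alt_def distinct_adj_append_iff last_map)
  have "\<phi> (ev pre * X b ^ q) = 0" for q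
    by (rule phi_ev_right[OF b(3) Cons.prems(2) _ b(1,2)]) (auto intro: salg_power salg_gen)
  moreover have "sd a (ev (pre @ [i])) its = 0"
    using Cons.IH[of "pre @ [i]"] Cons.prems by simp
  ultimately show ?case by (auto simp: i)
qed simp

text \<open>Both terms of the defect vanish. In the first, \<open>X a\<close> is either a new factor
  or merges with the first factor, which is followed by a nonempty rest. In \<open>sd\<close>, only
  differentiating the first factor avoids a centred prefix, and then the right leg vanishes. A
  single factor in \<open>X a\<close> is the exception.\<close>

lemma sd_defect_centred:
  assumes its: "centred_alt its" "its \<noteq> []" and a: "a \<in> {1..d}" and nt: "\<And>p c. its \<noteq> [(a, p, c)]"
  shows "sd_defect s a its = 0"
proof -
  obtain b p c rest where e: "its = (b, p, c) # rest" by (metis its(2) neq_Nil_conv prod_cases3)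
  have b: "b \<in> {1..d}" and rest: "centred_alt rest"
    using its centred_alt_append(2)[of "[(b, p, c)]" rest] by (auto simp: e centred_alt_def)
  have "fst (hd rest) \<noteq> b" if "rest \<noteq> []"
    using its that by (auto simp: e centred_alt_def distinct_adj_Cons hd_map)
  then have left: "\<phi> (y * ev rest) = 0" if "rest \<noteq> []" "y \<in> salg {X b}" for y
    using phi_left_ev[OF rest that(1) that(2) b] that by metis
  have "\<phi> (X a * ev its) = 0"
  proof (cases "b = a")
    case True
    then have "rest \<noteq> []" using nt e by auto
    then have "\<phi> ((X a * factor (b, p, c)) * ev rest) = 0"
      by (rule left) (use True factor_salg[of b p c] in \<open>auto intro: salg_mult salg_gen\<close>)
    then show ?thesis by (simp add: e mult.assoc)
  next
    case False
    then show ?thesis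
      using phi_left_ev[OF its, of "X a" a] a by (auto simp: e intro: salg_gen)
  qed
  moreover have "sd a 1 its = 0"
  proof -
    have "sd a (ev [(b, p, c)]) rest = 0"
      using sd_centred_prefix[of "[(b, p, c)]" rest a] its by (simp add: e)
    moreover have "\<phi> (X a ^ q * ev rest) = 0" if "b = a" for q
      using left[of "X a ^ q"] nt e that by (auto intro: salg_power salg_gen)
    ultimately show ?thesis by (simp add: e)
  qed
  ultimately show ?thesis by (simp add: sd_defect_def)
qed

text \<open>Runs of equal letters are merged into powers, because freeness needs distinct
  neighbours. The last conjunct keeps the word recoverable, which fixes the degree and identifies
  the one-block case.\<close>

lemma blocks_exist:
  "\<exists>its. distinct_adj (map fst its) \<and> (\<forall>(b, p, c)\<in>set its. p \<ge> 1 \<and> c = 0 \<and> b \<in> set w) \<and>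
     ev its = ev (letters w) \<and> (\<forall>x. sd a x its = sd a x (letters w)) \<and>
     w = concat (map (\<lambda>(b, p, c). replicate p b) its)"
proof (induction w)
  case Nil then show ?case by (intro exI[of _ "[]"]) (auto simp: letters_def)
next
  case (Cons b w)
  then obtain its where its: "distinct_adj (map fst its)"
    "\<forall>(b, p, c)\<in>set its. p \<ge> 1 \<and> c = 0 \<and> b \<in> set w" "ev its = ev (letters w)"
    "\<And>x. sd a x its = sd a x (letters w)" "w = concat (map (\<lambda>(b, p, c). replicate p b) its)"
    by blast
  have ev: "ev ((b, 1, 0) # its) = ev (letters (b # w))"
    and sd: "\<And>x. sd a x ((b, 1, 0) # its) = sd a x (letters (b # w))"
    using its by (simp_all add: letters_def)
  show ?case
  proof (cases "its \<noteq> [] \<and> fst (hd its) = b")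
    case True
    then obtain p rest where e: "its = (b, p, 0) # rest"
      using its(2) by (cases its) auto
    show ?thesis
    proof (intro exI[of _ "(b, Suc p, 0) # rest"] conjI)
      show "ev ((b, Suc p, 0) # rest) = ev (letters (b # w))"
        using ev unfolding e ev_Cons_Suc .
      show "\<forall>x. sd a x ((b, Suc p, 0) # rest) = sd a x (letters (b # w))"
        using sd unfolding e sd_Cons_Suc by blast
    qed (use its in \<open>auto simp: e\<close>)
  next
    case False
    show ?thesis
      by (intro exI[of _ "(b, 1, 0) # its"] conjI ev allI sd)
        (use its False in \<open>auto simp: distinct_adj_Cons hd_map\<close>)
  qed
qed

lemma deg_eq_length_concat: "deg its = length (concat (map (\<lambda>(b, p, c). replicate p b) its))"
  by (induction its) auto

text \<open>Constants are replaced one factor at a time. The correction is a multiple of the defect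
  of the product without that factor; its degree drops below \<open>L\<close> since
  \<open>p \<ge> 1\<close>, so it vanishes.\<close>

lemma sd_defect_centring:
  assumes "\<And>its. fst ` set its \<subseteq> {1..d} \<Longrightarrow> deg its < L \<Longrightarrow> sd_defect s a its = 0"
    and "fst ` set (pre @ its) \<subseteq> {1..d}" "deg (pre @ its) \<le> L" "\<forall>(b, p, c)\<in>set its. p \<ge> 1"
  shows "sd_defect s a (pre @ its) = sd_defect s a (pre @ map (\<lambda>(b, p, c). (b, p, m p)) its)"
  using assms(2-)
proof (induction its arbitrary: pre)
  case (Cons i its)
  obtain b p c where i: "i = (b, p, c)" by (cases i)
  have "sd_defect s a (pre @ its) = 0"
    by (rule assms(1)) (use Cons.prems in \<open>auto simp: i\<close>)
  then have "sd_defect s a (pre @ i # its) = sd_defect s a ((pre @ [(b, p, m p)]) @ its)"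
    unfolding i sd_defect_shift[of s a pre b p c its "m p"] by simp
  also have "\<dots> = sd_defect s a ((pre @ [(b, p, m p)]) @ map (\<lambda>(b, p, c). (b, p, m p)) its)"
    by (rule Cons.IH) (use Cons.prems in \<open>auto simp: i\<close>)
  finally show ?case by (simp add: i)
qed simp

text \<open>Induction on the length: shorter words have no defect, so the blocks of \<open>w\<close>
  may be centred at no cost. Freeness then kills the defect unless \<open>w\<close> is a power of
  \<open>X a\<close>, where it is the error of the one-variable recursion.\<close>

lemma sd_defect_letters:
  assumes rec: "\<And>k. k < N \<Longrightarrow> m (Suc k) = s * (\<Sum>q<k. m q * m (k - 1 - q))"
    and a: "a \<in> {1..d}" and w: "set w \<subseteq> {1..d}" "length w \<le> N"
  shows "sd_defect s a (letters w) =
    (if w = replicate N a then m (Suc N) - s * (\<Sum>q<N. m q * m (N - 1 - q)) else 0)"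
  using w
proof (induction "length w" arbitrary: w rule: less_induct)
  case less
  define L where "L = length w"
  \<comment> \<open>A word shorter than \<open>w\<close> is shorter than \<open>N\<close>, so it is
    not the exceptional word \<open>replicate N a\<close>.\<close>
  have small: "sd_defect s a (letters v) = 0" if "set v \<subseteq> {1..d}" "length v < L" for v
    using less.hyps[of v] that less.prems by (auto simp: L_def)
  have items: "sd_defect s a its = 0" if "fst ` set its \<subseteq> {1..d}" "deg its < L" for its
    using sd_defect_eq_zero_of_letters[of L s a its "[]"] small that by (simp add: letters_def)
  obtain its where its: "distinct_adj (map fst its)"
    "\<forall>(b, p, c)\<in>set its. p \<ge> 1 \<and> c = 0 \<and> b \<in> set w" "ev its = ev (letters w)"
    "\<And>x. sd a x its = sd a x (letters w)" "w = concat (map (\<lambda>(b, p, c). replicate p b) its)"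
    using blocks_exist[of w a] by blast
  have eq: "sd_defect s a (letters w) = sd_defect s a its"
    by (simp add: sd_defect_def its)
  have single: "sd_defect s a [(a, p, 0)] = m (Suc p) - s * (\<Sum>q<p. m q * m (p - 1 - q))" for p
    using mom[OF a, of "Suc p"] by (simp add: sd_defect_def factor_zero mom[OF a])
  show ?case
  proof (cases "\<exists>p c. its = [(a, p, c)]")
    case True
    then obtain p where p: "its = [(a, p, 0)]" using its(2) by auto
    then have w: "w = replicate p a" using its(5) by simp
    then have "p \<le> N" using less.prems by simp
    moreover have "sd_defect s a (letters w) = m (Suc p) - s * (\<Sum>q<p. m q * m (p - 1 - q))"
      by (simp only: eq p single)
    ultimately show ?thesis
      using rec[of p] by (cases "p = N") (auto simp: w)
  next
    case False
    \<comment> \<open>All blocks of a power of \<open>X a\<close> have index \<open>a\<close>, and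
      distinct neighbours then leave room for one block only.\<close>
    have nw: "w \<noteq> replicate N a" if ne: "its \<noteq> []"
    proof
      assume wN: "w = replicate N a"
      have "b = a" if "(b, p, c) \<in> set its" for b p c
        using its(2) that wN by auto
      then have "\<forall>b\<in>set (map fst its). b = a" by auto
      moreover obtain b p c rest where e: "its = (b, p, c) # rest"
        using ne by (cases its) auto
      ultimately have ba: "b = a" and all: "\<forall>b\<in>set (map fst rest). b = a" by simp_all
      then have "rest \<noteq> []" using False e by blast
      then have "hd (map fst rest) \<in> set (map fst rest)" by (intro hd_in_set) simp
      then have "hd (map fst rest) = a" using all by blast
      then show False using its(1) \<open>rest \<noteq> []\<close> ba by (simp add: e distinct_adj_Cons)
    qed
    show ?thesis
    proof (cases "its = []")
      case True
      then have "w = []" using its(5) by simp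
      moreover have "sd_defect s a [] = 0"
        using mom[OF a, of 1] centred by (simp add: sd_defect_def)
      \<comment> \<open>Covers \<open>N = 0\<close>, where the empty word is itself the exceptional
        one.\<close>
      moreover have "m (Suc 0) - s * (\<Sum>q<0. m q * m (0 - 1 - q)) = 0" using centred by simp
      ultimately show ?thesis by (cases "N = 0") (auto simp: letters_def)
    next
      case ne: False
      let ?c = "map (\<lambda>(b, p, c). (b, p, m p)) its"
      have fst: "map fst ?c = map fst its" by auto
      have sub: "fst ` set its \<subseteq> {1..d}" using its(2) less.prems by fastforce
      have "sd_defect s a ([] @ its) = sd_defect s a ([] @ ?c)"
        by (rule sd_defect_centring[of L])
          (use items sub its(2,5) in \<open>auto simp: L_def deg_eq_length_concat\<close>)
      also have "sd_defect s a ([] @ ?c) = 0"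
      proof (simp, rule sd_defect_centred[OF _ _ a])
        show "centred_alt ?c"
          using its(1) sub unfolding centred_alt_def fst by fastforce
        show "?c \<noteq> [(a, p, c)]" for p c
        proof
          assume "?c = [(a, p, c)]"
          then show False using False by (auto simp: map_eq_Cons_conv)
        qed
      qed (use ne in simp)
      finally show ?thesis using nw[OF ne] by (simp add: eq)
    qed
  qed
qed

lemma sd_letters:
  "sd a x (letters w) = (\<Sum>k<length w. if w ! k = a then
     \<phi> (x * prod_list (map X (take k w))) * \<phi> (prod_list (map X (drop (Suc k) w))) else 0)"
proof (induction w arbitrary: x)
  case (Cons b w)
  have "ev (letters w) = prod_list (map X w)"
    by (induction w) (simp_all add: letters_def factor_zero)
  then show ?case
    using Cons[of "x * X b"]
    by (simp add: letters_def sum.lessThan_Suc_shift factor_zero mult.assoc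
        del: sum.lessThan_Suc cong: if_cong)
qed (simp add: letters_def)

text \<open>On a word the difference quotient pairs \<open>X a\<close> with each equal letter and
  cuts the word there. The error of the recursion at order \<open>N\<close> enters only through
  \<open>w = replicate N a\<close>.\<close>

lemma schwinger_dyson:
  assumes rec: "\<And>k. k < N \<Longrightarrow> m (Suc k) = s * (\<Sum>q<k. m q * m (k - 1 - q))"
    and a: "a \<in> {1..d}" and w: "set w \<subseteq> {1..d}" "length w \<le> N"
  shows "\<phi> (X a * prod_list (map X w)) =
    s * (\<Sum>k<length w. if w ! k = a then
      \<phi> (prod_list (map X (take k w))) * \<phi> (prod_list (map X (drop (Suc k) w))) else 0) +
    (if w = replicate N a then m (Suc N) - s * (\<Sum>q<N. m q * m (N - 1 - q)) else 0)"
proof -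
  have "ev (letters w) = prod_list (map X w)"
    by (induction w) (simp_all add: letters_def factor_zero)
  then show ?thesis
    using sd_defect_letters[OF assms] by (simp add: sd_defect_def sd_letters algebra_simps cong: if_cong)
qed

end

subsection \<open>Operator-valued moments\<close>

definition words :: "nat \<Rightarrow> nat \<Rightarrow> nat list set" where
  "words d n = {v. set v \<subseteq> {1..d} \<and> length v = n}"

lemma words_0: "words d 0 = {[]}"
  by (auto simp: words_def)

lemma sum_words_Suc: "(\<Sum>v\<in>words d (Suc n). F v) = (\<Sum>i\<in>{1..d}. \<Sum>v\<in>words d n. F (i # v))"
proof -
  have "words d (Suc n) = (\<lambda>(i, v). i # v) ` ({1..d} \<times> words d n)"
    by (auto simp: words_def length_Suc_conv image_iff)
  moreover have "inj_on (\<lambda>(i, v). i # v) ({1..d} \<times> words d n)"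
    by (auto simp: inj_on_def)
  ultimately show ?thesis
    by (simp add: sum.reindex sum.cartesian_product case_prod_unfold comp_def)
qed

lemma sum_words_add:
  "(\<Sum>v\<in>words d (n + k). F v) = (\<Sum>v\<in>words d n. \<Sum>v'\<in>words d k. F (v @ v'))"
  by (induction n arbitrary: F) (simp_all add: words_0 sum_words_Suc)

text \<open>For words of equal length, the coefficient of \<open>X v1 X v2 ...\<close> in the
  expansion of the product of the \<open>Y w1, Y w2, ...\<close>.\<close>

definition matprod :: "(nat \<Rightarrow> nat \<Rightarrow> 'b::monoid_mult) \<Rightarrow> nat list \<Rightarrow> nat list \<Rightarrow> 'b" where
  "matprod u v w = prod_list (map2 u v w)"

lemma matprod_simps [simp]: "matprod u [] w = 1" "matprod u v [] = 1"
  "matprod u (i # v) (j # w) = u i j * matprod u v w"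
  by (simp_all add: matprod_def)

lemma matprod_append:
  "length v = length w \<Longrightarrow> matprod u (v @ v') (w @ w') = matprod u v w * matprod u v' w'"
  by (simp add: matprod_def)

lemma matprod_replicate: "matprod u (replicate n i) (replicate n j) = u i j ^ n"
  by (induction n) simp_all

text \<open>An element of \<open>\<A> \<otimes> \<B>\<close> acts on maps \<open>H :: 'a \<Rightarrow> 'b \<Rightarrow> 'b\<close> by right multiplication of the
  argument \<open>x \<otimes> b\<close>; only balanced maps descend to the tensor product. Products of elements become
  compositions of operators.\<close>

definition balanced :: "('a::star_algebra \<Rightarrow> 'b::star_algebra \<Rightarrow> 'b) \<Rightarrow> bool" where
  "balanced H \<longleftrightarrow> (\<forall>x y b. H (x + y) b = H x b + H y b) \<and> (\<forall>x b c. H x (b + c) = H x b + H x c) \<and>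
     (\<forall>c x b. H (cscale c x) b = H x (cscale c b))"

lemma balanced_zero: "balanced H \<Longrightarrow> H x 0 = 0"
  unfolding balanced_def by (metis add_cancel_right_right)

lemma balanced_minus: "balanced H \<Longrightarrow> H x (- b) = - H x b"
  using balanced_zero[of H x] unfolding balanced_def by (metis add.right_inverse minus_unique)

lemma balanced_sum: "balanced H \<Longrightarrow> H x (\<Sum>i\<in>A. f i) = (\<Sum>i\<in>A. H x (f i))"
  by (induction A rule: infinite_finite_induct) (auto simp: balanced_zero balanced_def)

lemma balanced_add: "balanced H \<Longrightarrow> balanced K \<Longrightarrow> balanced (\<lambda>x b. H x b + K x b)"
  by (auto simp: balanced_def algebra_simps)

lemma balanced_mult_right: "balanced H \<Longrightarrow> balanced (\<lambda>x b. H x (b * c))"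
  by (auto simp: balanced_def distrib_right cscale_mult_left)

text \<open>Generalises \<open>Ew\<close> from the final map \<open>cscale (\<phi> x) b\<close> to
  an arbitrary continuation \<open>H\<close>, so that words can be applied one after the
  other.\<close>

fun word_op :: "(nat \<Rightarrow> 'a::star_algebra) \<Rightarrow> (nat \<Rightarrow> nat \<Rightarrow> 'b::star_algebra) \<Rightarrow> nat \<Rightarrow>
    'b letter list \<Rightarrow> ('a \<Rightarrow> 'b \<Rightarrow> 'b) \<Rightarrow> 'a \<Rightarrow> 'b \<Rightarrow> 'b" where
  "word_op Z u d [] H x b = H x b"
| "word_op Z u d (LB c # w) H x b = word_op Z u d w H x (b * c)"
| "word_op Z u d (LY j # w) H x b = (\<Sum>i\<in>{1..d}. word_op Z u d w H (x * Z i) (b * u i j))"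

definition sum_op :: "(nat \<Rightarrow> 'a::star_algebra) \<Rightarrow> (nat \<Rightarrow> nat \<Rightarrow> 'b::star_algebra) \<Rightarrow> nat \<Rightarrow>
    'b letter list list \<Rightarrow> ('a \<Rightarrow> 'b \<Rightarrow> 'b) \<Rightarrow> 'a \<Rightarrow> 'b \<Rightarrow> 'b" where
  "sum_op Z u d ws H x b = (\<Sum>w\<leftarrow>ws. word_op Z u d w H x b)"

lemma Ew_eq_word_op: "Ew \<phi> Z u d x b w = word_op Z u d w (\<lambda>x b. cscale (\<phi> x) b) x b"
proof (induction w arbitrary: x b)
  case (Cons l w) then show ?case by (cases l) auto
qed simp

lemma Esum_eq_sum_op: "Esum \<phi> Z u d ws = sum_op Z u d ws (\<lambda>x b. cscale (\<phi> x) b) 1 1"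
  by (simp add: Esum_def sum_op_def Ew_eq_word_op)

lemma word_op_append: "word_op Z u d (w @ w') H x b = word_op Z u d w (word_op Z u d w' H) x b"
proof (induction w arbitrary: x b)
  case (Cons l w) then show ?case by (cases l) auto
qed simp

lemma sum_sum_list_swap: "(\<Sum>i\<in>A. \<Sum>k\<leftarrow>l. F i k) = (\<Sum>k\<leftarrow>l. \<Sum>i\<in>A. F i k)"
  by (induction l) (auto simp: sum.distrib)

lemma sum_list_concat: "sum_list (concat xss) = (\<Sum>xs\<leftarrow>xss. sum_list xs)"
  by (induction xss) auto

lemma word_op_sum_list:
  "word_op Z u d w (\<lambda>x b. \<Sum>k\<leftarrow>l. H k x b) x b = (\<Sum>k\<leftarrow>l. word_op Z u d w (H k) x b)"
proof (induction w arbitrary: x b)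
  case (Cons a w)
  show ?case
  proof (cases a)
    case (LY j)
    then show ?thesis by (simp add: Cons sum_sum_list_swap)
  qed (simp add: Cons)
qed simp

text \<open>Distributivity: it turns the concatenations in \<open>amalg_free_Y\<close> into a
  composition of one operator per factor.\<close>

lemma sum_op_product:
  "sum_op Z u d (map concat (product_lists as)) H = foldr (sum_op Z u d) as H"
proof (induction as)
  case Nil then show ?case by (simp add: sum_op_def fun_eq_iff)
next
  case (Cons ws as)
  have "sum_op Z u d (map concat (product_lists (ws # as))) H x b =
      (\<Sum>w\<leftarrow>ws. \<Sum>v\<leftarrow>product_lists as. word_op Z u d w (word_op Z u d (concat v) H) x b)" for x b
    by (simp add: sum_op_def map_concat sum_list_concat comp_def word_op_append)
  also have "\<dots> x b = sum_op Z u d ws (sum_op Z u d (map concat (product_lists as)) H) x b" for x b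
    unfolding sum_op_def word_op_sum_list by (simp add: comp_def)
  finally show ?case by (simp add: Cons fun_eq_iff)
qed

section \<open>Consequences of freeness with amalgamation\<close>

locale amalgamated_family = centred_free_family \<phi> d X m
  for \<phi> :: "'a::star_algebra \<Rightarrow> complex" and d X m +
  fixes u :: "nat \<Rightarrow> nat \<Rightarrow> 'b::star_algebra" and \<mu> :: complex
  assumes orth: "orth_quantum_matrix d u"
    and amalg: "amalg_free_Y \<phi> (\<lambda>i. X i + cscale \<mu> 1) u d"
begin

lemma orth_col: "j \<in> {1..d} \<Longrightarrow> j' \<in> {1..d} \<Longrightarrow>
    (\<Sum>i\<in>{1..d}. u i j * u i j') = (if j = j' then 1 else 0)"
  using orth by (simp add: orth_quantum_matrix_def)

declare foldr_replicate [simp del]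

text \<open>The variables \<open>X i\<close> of the locale are centred, while freeness with
  amalgamation is given for the uncentred ones.\<close>

abbreviation "Z \<equiv> \<lambda>i. X i + cscale \<mu> 1"

definition E0 :: "'a \<Rightarrow> 'b \<Rightarrow> 'b" where "E0 x b = cscale (\<phi> x) b"

definition Yop :: "nat \<Rightarrow> ('a \<Rightarrow> 'b \<Rightarrow> 'b) \<Rightarrow> 'a \<Rightarrow> 'b \<Rightarrow> 'b" where
  "Yop j H x b = (\<Sum>i\<in>{1..d}. H (x * X i) (b * u i j))"

text \<open>The sum of words representing the centred variable \<open>Y\<^sub>j - E(Y\<^sub>j) = \<Sum>\<^sub>i X\<^sub>i \<otimes> u\<^sub>i\<^sub>j\<close>.\<close>

definition Yc :: "nat \<Rightarrow> 'b letter list list" where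
  "Yc j = [[LY j], [LB (- cscale \<mu> (\<Sum>i\<in>{1..d}. u i j))]]"

text \<open>The conditional expectation of the product of the centred variables
  \<open>Y\<^sub>j - E(Y\<^sub>j)\<close> along \<open>w\<close>.\<close>

definition Emom :: "nat list \<Rightarrow> 'b" where
  "Emom w = foldr Yop w E0 1 1"

lemma balanced_E0: "balanced E0"
  by (auto simp: balanced_def E0_def phi_add phi_scale cscale_add_left cscale_add_right
      cscale_cscale mult.commute)

lemma balanced_Yop: "balanced H \<Longrightarrow> balanced (Yop j H)"
  by (auto simp: balanced_def Yop_def distrib_right sum.distrib cscale_mult_left)

lemma balanced_Yops: "balanced H \<Longrightarrow> balanced (foldr Yop w H)"
  by (induction w) (auto intro: balanced_Yop)

text \<open>Balancedness moves the scalar \<open>\<mu>\<close> from the first leg to the second,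
  where the letter \<open>LB\<close> of \<open>Yc\<close> cancels it.\<close>

lemma sum_op_Yc: "balanced H \<Longrightarrow> sum_op Z u d (Yc j) H = Yop j H"
proof (intro ext)
  fix x b assume H: "balanced H"
  have "H (x * Z i) (b * u i j) = H (x * X i) (b * u i j) + H x (cscale \<mu> (b * u i j))" for i
    using H by (simp add: distrib_left cscale_mult_right balanced_def)
  moreover have "H x (b * - cscale \<mu> (\<Sum>i\<in>{1..d}. u i j)) =
      - (\<Sum>i\<in>{1..d}. H x (cscale \<mu> (b * u i j)))"
    using H by (simp add: balanced_minus balanced_sum cscale_mult_right sum_distrib_left
        cscale_sum_right)
  ultimately show "sum_op Z u d (Yc j) H x b = Yop j H x b"
    by (simp add: sum_op_def Yc_def Yop_def sum.distrib)
qed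

lemma sum_op_Yc_power:
  assumes "balanced H"
  shows "foldr (sum_op Z u d) (replicate n (Yc j)) H = foldr Yop (replicate n j) H"
  by (induction n) (simp_all add: sum_op_Yc balanced_Yops[OF assms])

text \<open>Words for the \<open>n\<close>-th power of the centred variable minus its expectation,
  the elements fed into freeness with amalgamation.\<close>

definition Ycp :: "nat \<Rightarrow> nat \<Rightarrow> 'b letter list list" where
  "Ycp n j = map concat (product_lists (replicate n (Yc j))) @ [[LB (- Emom (replicate n j))]]"

lemma sum_op_Ycp:
  assumes "balanced H"
  shows "sum_op Z u d (Ycp n j) H x b =
    foldr Yop (replicate n j) H x b + H x (b * - Emom (replicate n j))"
proof -
  have "sum_op Z u d (Ycp n j) H x b =
      sum_op Z u d (map concat (product_lists (replicate n (Yc j)))) H x b +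
      H x (b * - Emom (replicate n j))"
    by (simp add: Ycp_def sum_op_def)
  then show ?thesis by (simp only: sum_op_product sum_op_Yc_power[OF assms])
qed

lemma Yc_letters: "w \<in> set (Yc j) \<Longrightarrow> l \<in> set w \<Longrightarrow> l \<in> range LB \<or> l = LY j"
  by (auto simp: Yc_def)

lemma Ycp_letters: "w \<in> set (Ycp n j) \<Longrightarrow> l \<in> set w \<Longrightarrow> l \<in> range LB \<or> l = LY j"
proof -
  assume w: "w \<in> set (Ycp n j)" and l: "l \<in> set w"
  show ?thesis
  proof (cases "w = [LB (- Emom (replicate n j))]")
    case False
    then obtain v where v: "v \<in> set (product_lists (replicate n (Yc j)))" "w = concat v"
      using w by (auto simp: Ycp_def)
    then obtain t where t: "t \<in> set v" "l \<in> set t" using l by auto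
    have "list_all2 (\<lambda>x ys. x \<in> set ys) v (replicate n (Yc j))"
      using v(1) by (simp add: product_lists_set)
    then have "t \<in> set (Yc j)"
      using t(1) by (auto simp: list_all2_conv_all_nth in_set_conv_nth)
    then show ?thesis using t(2) Yc_letters by blast
  qed (use l in auto)
qed

lemma phi_X: "i \<in> {1..d} \<Longrightarrow> \<phi> (X i) = 0"
  using mom[of i 1] centred by simp

lemma Esum_Yc: "Esum \<phi> Z u d (Yc j) = 0"
proof -
  have "Esum \<phi> Z u d (Yc j) = sum_op Z u d (Yc j) E0 1 1"
    by (simp add: Esum_eq_sum_op E0_def[abs_def])
  also have "\<dots> = 0"
    by (simp add: sum_op_Yc balanced_E0 Yop_def E0_def phi_X)
  finally show ?thesis .
qed

lemma Esum_Ycp: "Esum \<phi> Z u d (Ycp n j) = 0"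
proof -
  have "Esum \<phi> Z u d (Ycp n j) = sum_op Z u d (Ycp n j) E0 1 1"
    by (simp add: Esum_eq_sum_op E0_def[abs_def])
  also have "\<dots> = 0"
    by (simp add: sum_op_Ycp balanced_E0 Emom_def[symmetric])
      (simp add: E0_def phi_one cscale_one)
  finally show ?thesis .
qed

lemma amalg_apply:
  assumes "length as = length ks" "ks \<noteq> []" "distinct_adj ks" "set ks \<subseteq> {1..d}"
    and "\<And>r. r < length ks \<Longrightarrow> as ! r = Yc (ks ! r) \<or> (\<exists>n. as ! r = Ycp n (ks ! r))"
  shows "foldr (sum_op Z u d) as E0 1 1 = 0"
proof -
  have "ks ! r \<in> {1..d} \<and> (\<forall>w\<in>set (as ! r). \<forall>l\<in>set w. l \<in> range LB \<or> l = LY (ks ! r)) \<and>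
      Esum \<phi> Z u d (as ! r) = 0" if r: "r < length ks" for r
  proof (intro conjI ballI)
    show "ks ! r \<in> {1..d}" using assms(4) r nth_mem by blast
    show "Esum \<phi> Z u d (as ! r) = 0" using assms(5)[OF r] Esum_Yc Esum_Ycp by metis
    show "l \<in> range LB \<or> l = LY (ks ! r)" if "w \<in> set (as ! r)" "l \<in> set w" for w l
      using assms(5)[OF r] Yc_letters Ycp_letters that by metis
  qed
  then have "Esum \<phi> Z u d (map concat (product_lists as)) = 0"
    using amalg assms(1,2,3) unfolding amalg_free_Y_def distinct_adj_conv_nth by blast
  then show ?thesis
    by (simp add: Esum_eq_sum_op sum_op_product E0_def[abs_def])
qed

text \<open>Freeness kills the product of the first variable with the centred power. The subtracted
  term also vanishes, because each \<open>X i\<close> has expectation zero.\<close>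

lemma Emom_two_blocks:
  assumes "j \<in> {1..d}" "j' \<in> {1..d}" "j \<noteq> j'"
  shows "Emom (j # replicate n j') = 0"
proof -
  have "0 = foldr (sum_op Z u d) [Yc j, Ycp n j'] E0 1 1"
    by (rule amalg_apply[symmetric, of _ "[j, j']"])
      (use assms in \<open>auto simp: less_Suc_eq nth_Cons'\<close>)
  also have "\<dots> = sum_op Z u d (Yc j)
      (\<lambda>x b. foldr Yop (replicate n j') E0 x b + E0 x (b * - Emom (replicate n j'))) 1 1"
    by (simp add: sum_op_Ycp[OF balanced_E0, abs_def])
  also have "\<dots> = Yop j (\<lambda>x b. foldr Yop (replicate n j') E0 x b + E0 x (b * - Emom (replicate n j'))) 1 1"
    by (subst sum_op_Yc) (intro balanced_add balanced_Yops balanced_mult_right balanced_E0 refl)+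
  also have "\<dots> = Emom (j # replicate n j')"
    by (simp add: Yop_def[of j] sum.distrib Emom_def) (simp add: E0_def phi_X)
  finally show ?thesis ..
qed

text \<open>Expand the vanishing expectation of the alternating product whose middle factor is the
  centred power. As \<open>f\<close> is a scalar, the subtracted term can be pulled out from between
  the outer variables. Only neighbours must differ, so \<open>j'' = j\<close> is allowed.\<close>

lemma Emom_three_blocks:
  assumes "j \<in> {1..d}" "j' \<in> {1..d}" "j'' \<in> {1..d}" "j \<noteq> j'" "j' \<noteq> j''"
    and f: "Emom (replicate n j') = cscale f 1"
  shows "Emom (j # replicate n j' @ [j'']) = cscale f (Emom [j, j''])"
proof -
  let ?K = "Yop j'' E0"
  have K: "balanced ?K" by (intro balanced_Yop balanced_E0)
  have "0 = foldr (sum_op Z u d) [Yc j, Ycp n j', Yc j''] E0 1 1"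
    by (rule amalg_apply[symmetric, of _ "[j, j', j'']"])
      (use assms in \<open>auto simp: less_Suc_eq nth_Cons'\<close>)
  also have "\<dots> = sum_op Z u d (Yc j)
      (\<lambda>x b. foldr Yop (replicate n j') ?K x b + ?K x (b * - Emom (replicate n j'))) 1 1"
    by (simp add: sum_op_Ycp[OF K, abs_def] sum_op_Yc[OF balanced_E0])
  also have "\<dots> = Yop j (\<lambda>x b. foldr Yop (replicate n j') ?K x b + ?K x (b * - Emom (replicate n j'))) 1 1"
    by (subst sum_op_Yc) (intro balanced_add balanced_Yops balanced_mult_right K refl)+
  also have "\<dots> = Emom (j # replicate n j' @ [j'']) - cscale f (Emom [j, j''])"
  proof -
    have "?K x (b * - cscale f 1) = - cscale f (?K x b)" for x b
      by (simp add: balanced_minus[OF K] cscale_mult_right)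
        (simp add: Yop_def E0_def cscale_mult_left cscale_cscale cscale_sum_right mult.commute)
    then show ?thesis
      unfolding f by (simp add: Yop_def[of j] sum.distrib Emom_def sum_subtractf cscale_sum_right)
  qed
  finally show ?thesis by simp
qed

section \<open>Expansion of the operator-valued moments over words in the \<open>X i\<close>\<close>

lemma Yops_eq_sum: "foldr Yop w H x b =
    (\<Sum>v\<in>words d (length w). H (x * prod_list (map X v)) (b * matprod u v w))"
proof (induction w arbitrary: x b)
  case (Cons j w)
  then show ?case by (simp add: Yop_def sum_words_Suc mult.assoc)
qed (simp add: words_0)

lemma Emom_eq_sum: "Emom w =
    (\<Sum>v\<in>words d (length w). cscale (\<phi> (prod_list (map X v))) (matprod u v w))"
  by (simp add: Emom_def Yops_eq_sum E0_def)

text \<open>Once the letter at position \<open>k\<close> is fixed, the scalar and the matrix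
  coefficient both factor, and the sums over the letters before and after \<open>k\<close> are
  independent.\<close>

lemma sum_words_split_at:
  assumes w: "k < length w"
  shows "(\<Sum>v\<in>words d (length w). if v ! k = i then
      cscale (\<phi> (prod_list (map X (take k v))) * \<phi> (prod_list (map X (drop (Suc k) v))))
        (b * matprod u v w) else 0) =
    (if i \<in> {1..d} then b * Emom (take k w) * u i (w ! k) * Emom (drop (Suc k) w) else 0)"
proof -
  let ?P = "\<lambda>v. \<phi> (prod_list (map X v))"
  let ?w1 = "take k w" and ?w2 = "drop (Suc k) w"
  define l where "l = length ?w2"
  have len: "length w = k + Suc l" using w by (simp add: l_def)
  have weq: "w = ?w1 @ (w ! k) # ?w2" using w by (simp add: id_take_nth_drop)
  have "(\<Sum>v\<in>words d (length w). if v ! k = i then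
      cscale (?P (take k v) * ?P (drop (Suc k) v)) (b * matprod u v w) else 0) =
    (\<Sum>v\<in>words d k. \<Sum>i'\<in>{1..d}. \<Sum>v'\<in>words d l. if i' = i then
      cscale (?P v * ?P v') (b * (matprod u v ?w1 * (u i' (w ! k) * matprod u v' ?w2))) else 0)"
    unfolding len sum_words_add sum_words_Suc
  proof (intro sum.cong refl)
    fix v i' v' assume v: "v \<in> words d k" "v' \<in> words d l"
    have lv: "length v = k" using v by (simp add: words_def)
    have "matprod u (v @ i' # v') w = matprod u v ?w1 * (u i' (w ! k) * matprod u v' ?w2)"
      by (subst weq, subst matprod_append) (use lv w in simp_all)
    then show "(if (v @ i' # v') ! k = i then cscale (?P (take k (v @ i' # v')) *
        ?P (drop (Suc k) (v @ i' # v'))) (b * matprod u (v @ i' # v') w) else 0) =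
      (if i' = i then cscale (?P v * ?P v')
        (b * (matprod u v ?w1 * (u i' (w ! k) * matprod u v' ?w2))) else 0)"
      using lv by (auto simp: nth_append)
  qed
  also have "\<dots> = (\<Sum>v\<in>words d k. \<Sum>i'\<in>{1..d}. if i' = i then \<Sum>v'\<in>words d l.
      cscale (?P v * ?P v') (b * (matprod u v ?w1 * (u i (w ! k) * matprod u v' ?w2))) else 0)"
    by (intro sum.cong refl) simp
  also have "\<dots> = (if i \<in> {1..d} then \<Sum>v\<in>words d k. \<Sum>v'\<in>words d l.
      cscale (?P v * ?P v') (b * (matprod u v ?w1 * (u i (w ! k) * matprod u v' ?w2))) else 0)"
    by (cases "i \<in> {1..d}") (simp_all add: sum.delta del: atLeastAtMost_iff One_nat_def)
  also have "(\<Sum>v\<in>words d k. \<Sum>v'\<in>words d l.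
      cscale (?P v * ?P v') (b * (matprod u v ?w1 * (u i (w ! k) * matprod u v' ?w2)))) =
    b * Emom ?w1 * u i (w ! k) * Emom ?w2"
  proof -
    have l1: "length ?w1 = k" using w by simp
    have dist: "b * (\<Sum>v\<in>A. f v) * e * (\<Sum>v'\<in>B. g v') = (\<Sum>v\<in>A. \<Sum>v'\<in>B. b * f v * e * g v')"
      for A B :: "nat list set" and e :: 'b and f g
      by (simp only: sum_product[symmetric]) (simp only: sum_distrib_left sum_distrib_right)
    have assoc: "b * cscale p y * e * cscale p' z = cscale (p * p') (b * (y * (e * z)))"
      for p p' and y z e :: 'b
      by (simp add: cscale_mult_left cscale_mult_right cscale_cscale mult.assoc mult.commute[of p' p])
    show ?thesis
      unfolding Emom_eq_sum l1 l_def[symmetric] dist assoc ..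
  qed
  finally show ?thesis .
qed

lemma finite_words: "finite (words d n)"
  unfolding words_def by (rule finite_lists_length_eq) simp

text \<open>The Schwinger-Dyson equation is applied to each word of the expansion and resummed by
  \<open>sum_words_split_at\<close>. At length \<open>N\<close>, the constant words contribute the
  error \<open>c\<close>.\<close>

lemma Emom_Cons:
  fixes N s
  defines "c \<equiv> m (Suc N) - s * (\<Sum>q<N. m q * m (N - 1 - q))"
  assumes rec: "\<And>k. k < N \<Longrightarrow> m (Suc k) = s * (\<Sum>q<k. m q * m (k - 1 - q))"
    and w: "length w \<le> N"
  shows "Emom (j # w) =
    cscale s (\<Sum>k<length w. \<Sum>i\<in>{1..d}.
      u i j * Emom (take k w) * u i (w ! k) * Emom (drop (Suc k) w)) +
    (if length w = N then cscale c (\<Sum>i\<in>{1..d}. u i j * matprod u (replicate N i) w) else 0)"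
proof -
  let ?P = "\<lambda>v. \<phi> (prod_list (map X v))"
  let ?F = "\<lambda>i k v. if v ! k = i then cscale (?P (take k v) * ?P (drop (Suc k) v))
      (u i j * matprod u v w) else 0"
  let ?R = "\<lambda>i v. if v = replicate N i then cscale c (u i j * matprod u v w) else 0"
  have "Emom (j # w) = (\<Sum>i\<in>{1..d}. \<Sum>v\<in>words d (length w).
      cscale (\<phi> (X i * prod_list (map X v))) (u i j * matprod u v w))"
    by (simp add: Emom_eq_sum sum_words_Suc)
  also have "\<dots> = (\<Sum>i\<in>{1..d}. \<Sum>v\<in>words d (length w).
      cscale s (\<Sum>k<length w. ?F i k v) + ?R i v)"
  proof (intro sum.cong refl)
    fix i v assume i: "i \<in> {1..d}" and v: "v \<in> words d (length w)"
    have lv: "length v = length w" "set v \<subseteq> {1..d}" using v by (auto simp: words_def)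
    have "\<phi> (X i * prod_list (map X v)) =
        s * (\<Sum>k<length v. if v ! k = i then ?P (take k v) * ?P (drop (Suc k) v) else 0) +
        (if v = replicate N i then c else 0)"
      unfolding c_def by (rule schwinger_dyson[OF rec i lv(2)]) (use lv w in auto)
    moreover have "cscale (if t then a else 0) b = (if t then cscale a b else 0)"
      for t a and b :: 'b by simp
    ultimately show "cscale (\<phi> (X i * prod_list (map X v))) (u i j * matprod u v w) =
        cscale s (\<Sum>k<length w. ?F i k v) + ?R i v"
      by (simp only: cscale_add_left cscale_cscale[symmetric] cscale_sum_left lv)
  qed
  also have "\<dots> = cscale s (\<Sum>i\<in>{1..d}. \<Sum>v\<in>words d (length w). \<Sum>k<length w. ?F i k v) +
      (\<Sum>i\<in>{1..d}. \<Sum>v\<in>words d (length w). ?R i v)"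
    by (simp only: sum.distrib cscale_sum_right)
  also have "(\<Sum>i\<in>{1..d}. \<Sum>v\<in>words d (length w). \<Sum>k<length w. ?F i k v) =
      (\<Sum>i\<in>{1..d}. \<Sum>k<length w. \<Sum>v\<in>words d (length w). ?F i k v)"
    by (intro sum.cong refl sum.swap)
  also have "\<dots> = (\<Sum>k<length w. \<Sum>i\<in>{1..d}. \<Sum>v\<in>words d (length w). ?F i k v)"
    by (rule sum.swap)
  also have "\<dots> = (\<Sum>k<length w. \<Sum>i\<in>{1..d}.
      u i j * Emom (take k w) * u i (w ! k) * Emom (drop (Suc k) w))"
    by (intro sum.cong refl) (subst sum_words_split_at, auto)
  also have "(\<Sum>i\<in>{1..d}. \<Sum>v\<in>words d (length w). ?R i v) =
      (\<Sum>i\<in>{1..d}. if length w = N then cscale c (u i j * matprod u (replicate N i) w) else 0)"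
    by (intro sum.cong refl, subst sum.delta[OF finite_words]) (auto simp: words_def)
  also have "\<dots> = (if length w = N then cscale c (\<Sum>i\<in>{1..d}. u i j * matprod u (replicate N i) w) else 0)"
    by (simp add: cscale_sum_right)
  finally show ?thesis .
qed

text \<open>If shorter moments are scalars, column orthogonality turns the recursion for
  \<open>Emom\<close> into the scalar one. For \<open>w = replicate N j\<close> the scalar moment
  already contains \<open>c\<close>, which must be removed before the operator-valued error is
  added.\<close>

lemma Emom_eq_moment:
  fixes N s
  defines "c \<equiv> m (Suc N) - s * (\<Sum>q<N. m q * m (N - 1 - q))"
  assumes rec: "\<And>k. k < N \<Longrightarrow> m (Suc k) = s * (\<Sum>q<k. m q * m (k - 1 - q))"
    and w: "length w \<le> N" "set w \<subseteq> {1..d}" "j \<in> {1..d}"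
  shows "Emom (j # w) =
    cscale (\<phi> (X j * prod_list (map X w)) - (if w = replicate N j then c else 0)) 1 +
    (if length w = N then cscale c (\<Sum>i\<in>{1..d}. u i j * matprod u (replicate N i) w) else 0)"
  using w
proof (induction "length w" arbitrary: w j rule: less_induct)
  case less
  let ?P = "\<lambda>v. \<phi> (prod_list (map X v))"
  \<comment> \<open>The tail of \<open>v\<close> is shorter than \<open>w\<close>, hence shorter
    than \<open>N\<close>, and both error terms are absent.\<close>
  have small: "Emom v = cscale (?P v) 1" if v: "set v \<subseteq> {1..d}" "length v \<le> length w"
    for v
  proof (cases v)
    case Nil then show ?thesis by (simp add: Emom_def E0_def)
  next
    case (Cons j' w')
    then show ?thesis using less.hyps[of w' j'] less.prems v by auto
  qed
  have "(\<Sum>i\<in>{1..d}. u i j * Emom (take k w) * u i (w ! k) * Emom (drop (Suc k) w)) =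
      cscale (if w ! k = j then ?P (take k w) * ?P (drop (Suc k) w) else 0) 1"
    if k: "k < length w" for k
  proof -
    have wk: "w ! k \<in> {1..d}" using less.prems k nth_mem by blast
    have "Emom (take k w) = cscale (?P (take k w)) 1"
      by (rule small) (use less.prems set_take_subset[of k w] in auto)
    moreover have "Emom (drop (Suc k) w) = cscale (?P (drop (Suc k) w)) 1"
      by (rule small) (use less.prems set_drop_subset[of "Suc k" w] in auto)
    ultimately have "(\<Sum>i\<in>{1..d}. u i j * Emom (take k w) * u i (w ! k) * Emom (drop (Suc k) w)) =
        cscale (?P (take k w) * ?P (drop (Suc k) w)) (\<Sum>i\<in>{1..d}. u i j * u i (w ! k))"
      by (simp add: cscale_mult_left cscale_mult_right cscale_cscale cscale_sum_right mult.commute)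
    then show ?thesis using orth_col[OF less.prems(3) wk] by auto
  qed
  then have "cscale s (\<Sum>k<length w. \<Sum>i\<in>{1..d}.
      u i j * Emom (take k w) * u i (w ! k) * Emom (drop (Suc k) w)) =
    cscale (s * (\<Sum>k<length w. if w ! k = j then ?P (take k w) * ?P (drop (Suc k) w) else 0)) 1"
    by (simp add: cscale_sum_left[symmetric] cscale_cscale)
  also have "s * (\<Sum>k<length w. if w ! k = j then ?P (take k w) * ?P (drop (Suc k) w) else 0) =
      \<phi> (X j * prod_list (map X w)) - (if w = replicate N j then c else 0)"
    using schwinger_dyson[OF rec less.prems(3,2,1)] by (simp add: c_def)
  finally show ?case
    using Emom_Cons[OF rec less.prems(1), of j] by (simp add: c_def)
qed

lemma Emom_small:
  assumes rec: "\<And>k. k < N \<Longrightarrow> m (Suc k) = s * (\<Sum>q<k. m q * m (k - 1 - q))"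
    and w: "length w \<le> N" "set w \<subseteq> {1..d}"
  shows "Emom w = cscale (\<phi> (prod_list (map X w))) 1"
proof (cases w)
  case Nil then show ?thesis by (simp add: Emom_def E0_def)
next
  case (Cons j v)
  then show ?thesis using Emom_eq_moment[OF rec, where w = v and j = j] w by auto
qed

text \<open>The moment of \<open>j # ?w\<close> is computed twice: freeness with amalgamation gives
  the scalar moment alone, \<open>Emom_eq_moment\<close> gives it plus the nonzero error times the
  sum in question.\<close>

lemma matrix_entries_mixed:
  assumes rec: "\<And>k. k < N \<Longrightarrow> m (Suc k) = s * (\<Sum>q<k. m q * m (k - 1 - q))"
    and c: "m (Suc N) \<noteq> s * (\<Sum>q<N. m q * m (N - 1 - q))" and N: "N \<ge> 2"
    and j: "j \<in> {1..d}" "j' \<in> {1..d}" "j'' \<in> {1..d}" "j \<noteq> j'"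
  shows "(\<Sum>i\<in>{1..d}. u i j * u i j' ^ (N - 1) * u i j'') = 0"
proof -
  let ?r = "replicate (N - 1) j'"
  let ?w = "?r @ [j'']"
  let ?P = "\<lambda>v. \<phi> (prod_list (map X v))"
  have len: "length ?w = N" "set ?w \<subseteq> {1..d}" using N j by auto
  \<comment> \<open>As \<open>N \<ge> 2\<close>, the first letter of \<open>?w\<close> is
    \<open>j'\<close>, so the scalar moment carries no error.\<close>
  have nw: "?w \<noteq> replicate N j"
  proof
    assume "?w = replicate N j"
    then have "?w ! 0 = replicate N j ! 0" by simp
    then show False using N j(4) by (simp add: nth_append)
  qed
  \<comment> \<open>Only the last letter can pair with the initial \<open>X j\<close>.\<close>
  have wk: "?w ! k = j \<longleftrightarrow> k = N - 1 \<and> j'' = j" if "k < N" for k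
    using that j(4) by (auto simp: nth_append)
  have "\<phi> (X j * prod_list (map X ?w)) =
      s * (\<Sum>k<N. if ?w ! k = j then ?P (take k ?w) * ?P (drop (Suc k) ?w) else 0)"
    using schwinger_dyson[OF rec j(1) len(2)] len nw by simp
  also have "(\<Sum>k<N. if ?w ! k = j then ?P (take k ?w) * ?P (drop (Suc k) ?w) else 0) =
      (\<Sum>k<N. if k = N - 1 then (if j'' = j then ?P ?r else 0) else 0)"
  proof (intro sum.cong refl)
    fix k assume "k \<in> {..<N}"
    then have k: "(?w ! k = j) = (k = N - 1 \<and> j'' = j)" by (intro wk) simp
    show "(if ?w ! k = j then ?P (take k ?w) * ?P (drop (Suc k) ?w) else 0) =
        (if k = N - 1 then (if j'' = j then ?P ?r else 0) else 0)"
      unfolding k by (auto simp: phi_one)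
  qed
  also have "\<dots> = (if j'' = j then ?P ?r else 0)"
    using N by (simp add: sum.delta)
  finally have top: "\<phi> (X j * prod_list (map X ?w)) = s * (if j'' = j then ?P ?r else 0)" .
  have "Emom (j # ?w) = cscale (\<phi> (X j * prod_list (map X ?w))) 1"
  \<comment> \<open>If \<open>j'' = j'\<close>, the last letter joins the middle block and only two
    blocks remain.\<close>
  proof (cases "j'' = j'")
    case True
    have "?w = replicate N j'"
      using N True by (cases N) (auto simp: replicate_append_same)
    then have "Emom (j # ?w) = 0" using Emom_two_blocks[OF j(1,2,4), of N] by simp
    then show ?thesis using top True j(4) by simp
  next
    case False
    have "Emom ?r = cscale (?P ?r) 1" by (rule Emom_small[OF rec]) (use N j in auto)
    then have "Emom (j # ?w) = cscale (?P ?r) (Emom [j, j''])"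
      using Emom_three_blocks j False by auto
    also have "Emom [j, j''] = cscale (\<phi> (X j * X j'')) 1"
      using Emom_small[OF rec, where w = "[j, j'']"] N j by simp
    also have "\<phi> (X j * X j'') = s * (if j'' = j then 1 else 0)"
      using schwinger_dyson[OF rec j(1), where w = "[j'']"] N j
      by (auto simp: phi_one Cons_replicate_eq)
    finally show ?thesis using top by (simp add: cscale_cscale mult.commute)
  qed
  moreover have "Emom (j # ?w) = cscale (\<phi> (X j * prod_list (map X ?w))) 1 +
      cscale (m (Suc N) - s * (\<Sum>q<N. m q * m (N - 1 - q)))
        (\<Sum>i\<in>{1..d}. u i j * matprod u (replicate N i) ?w)"
    by (rule trans[OF Emom_eq_moment[OF rec eq_refl[OF len(1)] len(2) j(1)]])
      (simp_all only: if_not_P[OF nw] if_P[OF len(1)] diff_zero)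
  ultimately have "cscale (m (Suc N) - s * (\<Sum>q<N. m q * m (N - 1 - q)))
      (\<Sum>i\<in>{1..d}. u i j * matprod u (replicate N i) ?w) = 0"
    by (simp only: add_cancel_left_right)
  then have "(\<Sum>i\<in>{1..d}. u i j * matprod u (replicate N i) ?w) = 0"
    using c by (simp add: cscale_eq_0_iff)
  moreover have "matprod u (replicate N i) ?w = u i j' ^ (N - 1) * u i j''" for i
  proof -
    have "replicate N i = replicate (N - 1) i @ [i]"
      using N by (cases N) (auto simp: replicate_append_same)
    then show ?thesis by (simp add: matprod_append matprod_replicate)
  qed
  ultimately show ?thesis by (simp add: mult.assoc)
qed

text \<open>Multiply the mixed relation by \<open>u k j''\<close> and sum over \<open>j''\<close>:
  row orthogonality isolates the summand \<open>i = k\<close>.\<close>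

lemma matrix_entries_annihilate:
  assumes rec: "\<And>k. k < N \<Longrightarrow> m (Suc k) = s * (\<Sum>q<k. m q * m (k - 1 - q))"
    and c: "m (Suc N) \<noteq> s * (\<Sum>q<N. m q * m (N - 1 - q))" and N: "N \<ge> 2"
    and j: "k \<in> {1..d}" "j \<in> {1..d}" "j' \<in> {1..d}" "j \<noteq> j'"
  shows "u k j * u k j' ^ (N - 1) = 0"
proof -
  let ?A = "\<lambda>i. u i j * u i j' ^ (N - 1)"
  have row: "(\<Sum>l\<in>{1..d}. u i l * u k l) = (if i = k then 1 else 0)" if "i \<in> {1..d}" for i
    using orth that j(1) by (simp add: orth_quantum_matrix_def)
  have "0 = (\<Sum>l\<in>{1..d}. (\<Sum>i\<in>{1..d}. ?A i * u i l) * u k l)"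
    by (rule sum.neutral[symmetric])
      (use matrix_entries_mixed[OF rec c N j(2,3) _ j(4)] in auto)
  also have "\<dots> = (\<Sum>i\<in>{1..d}. ?A i * (\<Sum>l\<in>{1..d}. u i l * u k l))"
    unfolding sum_distrib_right sum_distrib_left mult.assoc by (rule sum.swap)
  also have "\<dots> = (\<Sum>i\<in>{1..d}. if i = k then ?A k else 0)"
    by (intro sum.cong refl) (simp add: row del: One_nat_def)
  also have "\<dots> = ?A k" using j(1) by (simp add: sum.delta)
  finally show ?thesis ..
qed

end

subsection \<open>Semicircularity\<close>

text \<open>The square of the norm of \<open>\<pi> y x\<close> is the inner product of
  \<open>x\<close> with \<open>\<pi> (sadj y * y) x\<close>, so \<open>\<pi> y\<close> is the zero
  operator.\<close>

lemma faithful_star_rep_sadj_mult_zero: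
  fixes \<pi> :: "'b::star_algebra \<Rightarrow> 'h::chilbert \<Rightarrow> 'h" and y :: 'b
  assumes rep: "faithful_star_rep \<pi>" and y: "sadj y * y = 0"
  shows "y = 0"
proof -
  have add: "\<And>b c x. \<pi> (b + c) x = \<pi> b x + \<pi> c x"
    and mult: "\<And>b c x. \<pi> (b * c) x = \<pi> b (\<pi> c x)"
    and adj: "\<And>b x y. hinner (\<pi> b x) y = hinner x (\<pi> (sadj b) y)"
    and inj: "inj \<pi>"
    using rep unfolding faithful_star_rep_def by blast+
  have zero: "\<pi> 0 x = 0" for x using add[of 0 0 x] by simp
  have "\<pi> y x = \<pi> 0 x" for x
  proof -
    have "hinner (\<pi> y x) (\<pi> y x) = hinner x (\<pi> (sadj y * y) x)"
      by (simp add: adj mult)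
    also have "\<dots> = 0"
      using hinner_add_right[of x 0 0] by (simp add: y zero)
    finally show ?thesis using hinner_definite zero by metis
  qed
  then show ?thesis using inj by (metis ext injD)
qed

lemma sadj_power: "sadj (x ^ n) = sadj x ^ n"
proof (induction n)
  case 0
  \<comment> \<open>\<open>sadj 1 * 1\<close> equals its own adjoint, so
    \<open>sadj 1 = sadj (sadj 1) = 1\<close>.\<close>
  have "sadj 1 = sadj 1 * (1::'a)" by simp
  also have "\<dots> = sadj (sadj 1 * 1)" unfolding sadj_mult sadj_sadj by simp
  finally show ?case by (simp add: sadj_sadj)
next
  case (Suc n) then show ?case by (simp add: sadj_mult power_commutes)
qed

lemma sadj_zero: "sadj 0 = (0::'a::star_algebra)"
  using sadj_add[of 0 "0::'a"] by simp

text \<open>One power is removed at a time: for \<open>y = t ^ Suc n * b\<close>, the product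
  \<open>sadj y * y\<close> ends in \<open>t ^ Suc (Suc n) * b\<close>, which is zero.\<close>

lemma selfadjoint_power_mult_eq_zero:
  fixes t b :: "'b::star_algebra" and \<pi> :: "'b \<Rightarrow> 'h::chilbert \<Rightarrow> 'h"
  assumes rep: "faithful_star_rep \<pi>" and t: "sadj t = t" and z: "t ^ Suc n * b = 0"
  shows "t * b = 0"
  using z
proof (induction n)
  case (Suc n)
  let ?y = "t ^ Suc n * b"
  have pw: "t ^ Suc n * t ^ Suc n = t ^ n * t ^ Suc (Suc n)"
    by (simp only: power_add[symmetric] add_Suc add_Suc_right)
  have "sadj ?y * ?y = sadj b * ((t ^ Suc n * t ^ Suc n) * b)"
    by (simp only: sadj_mult sadj_power t mult.assoc)
  also have "\<dots> = sadj b * (t ^ n * (t ^ Suc (Suc n) * b))"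
    by (simp only: pw mult.assoc)
  also have "\<dots> = 0" by (simp only: Suc.prems mult_zero_right)
  finally have "?y = 0" by (rule faithful_star_rep_sadj_mult_zero[OF rep])
  then show ?case by (rule Suc.IH)
qed simp

lemma orth_quantum_matrix_square_eq_fourth:
  fixes u :: "nat \<Rightarrow> nat \<Rightarrow> 'b::star_algebra"
  assumes orth: "orth_quantum_matrix d u" and i: "i \<in> {1..d}" and j: "j \<in> {1..d}"
    and z: "\<And>j'. j' \<in> {1..d} \<Longrightarrow> j' \<noteq> j \<Longrightarrow> u i j * u i j' = 0"
  shows "u i j ^ 2 = u i j ^ 4"
proof -
  have "u i j ^ 2 = u i j ^ 2 * (\<Sum>j'\<in>{1..d}. u i j' * u i j')"
    using orth i by (simp add: orth_quantum_matrix_def)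
  also have "\<dots> = (\<Sum>j'\<in>{1..d}. u i j ^ 2 * (u i j' * u i j'))"
    by (rule sum_distrib_left)
  also have "\<dots> = (\<Sum>j'\<in>{1..d}. if j' = j then u i j ^ 4 else 0)"
  proof (intro sum.cong refl)
    fix j' assume j': "j' \<in> {1..d}"
    show "u i j ^ 2 * (u i j' * u i j') = (if j' = j then u i j ^ 4 else 0)"
    proof (cases "j' = j")
      case True then show ?thesis by (simp add: power2_eq_square power4_eq_xxxx mult.assoc)
    next
      case False
      have "u i j ^ 2 * (u i j' * u i j') = u i j * ((u i j * u i j') * u i j')"
        by (simp add: power2_eq_square mult.assoc)
      then show ?thesis using z[OF j' False] False by simp
    qed
  qed
  also have "\<dots> = u i j ^ 4" using j by simp
  finally show ?thesis .
qed

text \<open>Adding a scalar changes only the first cumulant. This is proved on the level of moments,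
  through the mixed moments of \<open>y\<close> and \<open>x\<close>.\<close>

lemma (in ncp_space) shifted_moment_recursion:
  fixes x y :: 'a
  assumes x: "x = y + cscale \<mu> 1"
    and rec: "\<And>k. \<phi> (y ^ Suc k) = s * (\<Sum>q<k. \<phi> (y ^ q) * \<phi> (y ^ (k - 1 - q)))"
  shows "\<phi> (x ^ Suc k) = \<mu> * \<phi> (x ^ k) + s * (\<Sum>q<k. \<phi> (x ^ q) * \<phi> (x ^ (k - 1 - q)))"
proof -
  have step: "y ^ a * x ^ Suc b = y ^ Suc a * x ^ b + cscale \<mu> (y ^ a * x ^ b)" for a b
  proof -
    have "y ^ a * x ^ Suc b = y ^ a * (y + cscale \<mu> 1) * x ^ b"
      by (simp add: x mult.assoc)
    also have "\<dots> = y ^ Suc a * x ^ b + cscale \<mu> (y ^ a * x ^ b)"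
      by (simp add: algebra_simps cscale_mult_left cscale_mult_right power_commutes)
    finally show ?thesis .
  qed
  \<comment> \<open>The Schwinger-Dyson equation for \<open>y ^ a * x ^ b\<close>, where
    \<open>x\<close> and \<open>y\<close> have the same difference quotient. The induction replaces
    one \<open>x\<close> by \<open>y + \<mu>\<close>; the claim is the case
    \<open>a = 0\<close>.\<close>
  have main: "\<phi> (y ^ Suc a * x ^ b) = s * ((\<Sum>q<a. \<phi> (y ^ q) * \<phi> (y ^ (a - 1 - q) * x ^ b)) +
      (\<Sum>q<b. \<phi> (y ^ a * x ^ q) * \<phi> (x ^ (b - 1 - q))))" for a b
  proof (induction b arbitrary: a)
    case 0 show ?case using rec[of a] by simp
  next
    case (Suc b)
    let ?A = "\<Sum>q<a. \<phi> (y ^ q) * \<phi> (y ^ (a - q) * x ^ b)"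
    let ?A' = "\<Sum>q<a. \<phi> (y ^ q) * \<phi> (y ^ (a - 1 - q) * x ^ b)"
    let ?A'' = "\<Sum>q<a. \<phi> (y ^ q) * \<phi> (y ^ (a - 1 - q) * x ^ Suc b)"
    let ?B = "\<Sum>q<b. \<phi> (y ^ Suc a * x ^ q) * \<phi> (x ^ (b - 1 - q))"
    let ?B' = "\<Sum>q<b. \<phi> (y ^ a * x ^ q) * \<phi> (x ^ (b - 1 - q))"
    let ?B'' = "\<Sum>q<b. \<phi> (y ^ a * x ^ Suc q) * \<phi> (x ^ (b - 1 - q))"
    have A: "?A'' = ?A + \<mu> * ?A'"
      unfolding sum_distrib_left sum.distrib[symmetric]
    proof (intro sum.cong refl)
      fix q assume "q \<in> {..<a}"
      then have "Suc (a - 1 - q) = a - q" by auto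
      then show "\<phi> (y ^ q) * \<phi> (y ^ (a - 1 - q) * x ^ Suc b) =
          \<phi> (y ^ q) * \<phi> (y ^ (a - q) * x ^ b) +
          \<mu> * (\<phi> (y ^ q) * \<phi> (y ^ (a - 1 - q) * x ^ b))"
        unfolding step phi_add phi_scale by (simp add: distrib_left mult.left_commute)
    qed
    have B: "?B'' = ?B + \<mu> * ?B'"
      unfolding step phi_add phi_scale
      by (simp add: distrib_right sum.distrib sum_distrib_left mult.assoc)
    have "\<phi> (y ^ Suc a * x ^ Suc b) = \<phi> (y ^ Suc (Suc a) * x ^ b) + \<mu> * \<phi> (y ^ Suc a * x ^ b)"
      unfolding step[of "Suc a"] phi_add phi_scale ..
    also have "\<phi> (y ^ Suc (Suc a) * x ^ b) = s * ((?A + \<phi> (y ^ a) * \<phi> (x ^ b)) + ?B)"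
      unfolding Suc.IH[of "Suc a"] by simp
    also have "\<phi> (y ^ Suc a * x ^ b) = s * (?A' + ?B')"
      by (rule Suc.IH)
    also have "s * ((?A + \<phi> (y ^ a) * \<phi> (x ^ b)) + ?B) + \<mu> * (s * (?A' + ?B')) =
        s * (?A'' + (\<phi> (y ^ a) * \<phi> (x ^ b) + ?B''))"
      unfolding A B by (simp add: algebra_simps)
    also have "\<phi> (y ^ a) * \<phi> (x ^ b) + ?B'' =
        (\<Sum>q<Suc b. \<phi> (y ^ a * x ^ q) * \<phi> (x ^ (Suc b - 1 - q)))"
      by (simp only: sum.lessThan_Suc_shift) simp
    finally show ?case .
  qed
  have "\<phi> (x ^ Suc k) = \<phi> (y ^ Suc 0 * x ^ k) + \<mu> * \<phi> (x ^ k)"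
    using step[of 0 k] by (simp add: phi_add phi_scale)
  then show ?thesis unfolding main by simp
qed

lemma freely_independent_shift:
  assumes "freely_independent \<phi> d X" "\<And>i. i \<in> {1..d} \<Longrightarrow> Y i \<in> salg {X i}"
  shows "freely_independent \<phi> d Y"
proof -
  have "y \<in> salg {X i}" if "y \<in> salg {Y i}" "i \<in> {1..d}" for y i
    using salg_subset[of "{Y i}" "{X i}"] assms(2) that by blast
  then show ?thesis
    using assms(1) unfolding freely_independent_def by meson
qed

text \<open>Each factor \<open>z - \<mu>\<close> can be expanded in turn, so the mixed moments of
  \<open>z - \<mu>\<close> and \<open>z\<close> depend only on the moments of
  \<open>z\<close>.\<close>

lemma (in ncp_space) shifted_moments_cong:
  assumes "\<And>n. \<phi> (x ^ n) = \<phi> (y ^ n)"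
  shows "\<phi> ((x - cscale \<mu> 1) ^ n) = \<phi> ((y - cscale \<mu> 1) ^ n)"
proof -
  have "(z - cscale \<mu> 1) ^ Suc a * z ^ b =
      (z - cscale \<mu> 1) ^ a * z ^ Suc b - cscale \<mu> ((z - cscale \<mu> 1) ^ a * z ^ b)" for z :: 'a and a b
    unfolding power_Suc2[of "z - cscale \<mu> 1"]
    by (simp add: right_diff_distrib left_diff_distrib mult.assoc cscale_mult_left cscale_mult_right)
  then have "\<phi> ((x - cscale \<mu> 1) ^ a * x ^ b) = \<phi> ((y - cscale \<mu> 1) ^ a * y ^ b)" for a b
    by (induction a arbitrary: b) (simp_all add: assms phi_diff phi_scale del: power_Suc)
  from this[of n 0] show ?thesis by simp
qed

theorem mainTheorem1:
  fixes d :: nat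
    and u :: "nat \<Rightarrow> nat \<Rightarrow> 'b::star_algebra"
    and \<pi> :: "'b \<Rightarrow> 'h::chilbert \<Rightarrow> 'h"
    and \<phi> :: "'a::star_algebra \<Rightarrow> complex"
    and X :: "nat \<Rightarrow> 'a"
  assumes "d \<ge> 2"
    and "orth_quantum_matrix d u"
    and "faithful_star_rep \<pi>"
    and "ncps \<phi>"
    and "\<forall>i\<in>{1..d}. sadj (X i) = X i"
    and "freely_independent \<phi> d X"
    and "\<forall>i\<in>{1..d}. \<forall>j\<in>{1..d}. \<forall>n. \<phi> (X i ^ n) = \<phi> (X j ^ n)"
    and "amalg_free_Y \<phi> X u d"
  shows "(\<forall>i\<in>{1..d}. \<forall>j\<in>{1..d}. u i j ^ 2 = u i j ^ 4) \<or>
         (\<forall>\<kappa>. free_cumulants \<phi> \<kappa> \<longrightarrow>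
            (\<forall>i\<in>{1..d}. \<forall>n\<ge>3. \<kappa> (replicate n (X i)) = 0))"
proof -
  interpret ncp_space \<phi> by (simp add: ncp_space_def assms(4))
  define \<mu> where "\<mu> = \<phi> (X 1)"
  define Y where "Y i = X i - cscale \<mu> 1" for i
  define m where "m k = \<phi> (Y 1 ^ k)" for k
  have one: "1 \<in> {1..d}" using assms(1) by simp
  have mom: "\<phi> (Y i ^ k) = m k" if "i \<in> {1..d}" for i k
    unfolding m_def Y_def by (rule shifted_moments_cong) (use assms(7) that one in blast)
  have X: "X = (\<lambda>i. Y i + cscale \<mu> 1)" by (simp add: Y_def fun_eq_iff)
  have m1: "m 1 = 0" by (simp add: m_def Y_def \<mu>_def phi_diff phi_scale phi_one)
  interpret amalgamated_family \<phi> d Y m u \<mu>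
  proof
    show "freely_independent \<phi> d Y"
      by (rule freely_independent_shift[OF assms(6)])
        (auto simp: Y_def intro!: salg_diff salg_const intro: salg_gen)
    show "amalg_free_Y \<phi> (\<lambda>i. Y i + cscale \<mu> 1) u d"
      using assms(8) X by simp
  qed (use mom m1 assms(2) in auto)
  \<comment> \<open>The variance is the only possible choice: the recursion at \<open>k = 1\<close>
    reads \<open>m 2 = s\<close>. At \<open>k = 0\<close> it is the centring, so the first failure
    has \<open>N \<ge> 2\<close>.\<close>
  define s where "s = m 2"
  let ?rec = "\<lambda>k. m (Suc k) = s * (\<Sum>q<k. m q * m (k - 1 - q))"
  show ?thesis
  proof (cases "\<forall>k. ?rec k")
    case True
    have "\<kappa> (replicate n (X i)) = 0"
      if \<kappa>: "free_cumulants \<phi> \<kappa>" and i: "i \<in> {1..d}" and n: "n \<ge> 3" for \<kappa> i n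
    proof (rule free_cumulants_eq_zero[OF \<kappa> phi_one _ n])
      show "\<phi> (X i ^ Suc k) = \<mu> * \<phi> (X i ^ k) +
          s * (\<Sum>q<k. \<phi> (X i ^ q) * \<phi> (X i ^ (k - 1 - q)))" for k
      proof (rule shifted_moment_recursion)
        show "X i = Y i + cscale \<mu> 1" by (simp add: Y_def)
        show "\<phi> (Y i ^ Suc k) = s * (\<Sum>q<k. \<phi> (Y i ^ q) * \<phi> (Y i ^ (k - 1 - q)))" for k
          unfolding mom[OF i] using True by blast
      qed
    qed
    then show ?thesis by blast
  next
    case False
    define N where "N = (LEAST k. \<not> ?rec k)"
    have N: "\<not> ?rec N" unfolding N_def by (rule LeastI_ex) (use False in blast)
    have rec: "?rec k" if "k < N" for k using not_less_Least[OF that[unfolded N_def]] by blast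
    have "?rec 0" "?rec 1"
      using m1 by (simp_all add: s_def m_def phi_one numeral_2_eq_2)
    then have "N \<noteq> 0" "N \<noteq> 1" using N by metis+
    then have N2: "N \<ge> 2" by simp
    have "u k j * u k j' = 0" if k: "k \<in> {1..d}" "j \<in> {1..d}" "j' \<in> {1..d}" "j' \<noteq> j" for k j j'
    proof (rule selfadjoint_power_mult_eq_zero[OF assms(3), where n = "N - 2"])
      show sa: "sadj (u k j) = u k j"
        using assms(2) k by (simp add: orth_quantum_matrix_def)
      have sa': "sadj (u k j') = u k j'"
        using assms(2) k by (simp add: orth_quantum_matrix_def)
      have "u k j' * u k j ^ (N - 1) = 0"
        by (rule matrix_entries_annihilate[OF rec N N2 k(1,3,2,4)])
      \<comment> \<open>Passing to adjoints moves the power to the left, as the kernel argument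
        requires.\<close>
      then have "sadj (u k j' * u k j ^ (N - 1)) = 0" by (simp only: sadj_zero)
      moreover have "N - 1 = Suc (N - 2)" using N2 by simp
      ultimately show "u k j ^ Suc (N - 2) * u k j' = 0"
        by (simp only: sadj_mult sadj_power sa sa')
    qed
    then have "u i j ^ 2 = u i j ^ 4" if "i \<in> {1..d}" "j \<in> {1..d}" for i j
      using orth_quantum_matrix_square_eq_fourth[OF assms(2) that] that by blast
    then show ?thesis by blast
  qed
qed

end
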